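(* There exists an absolute constant $C$ such that, for all $\alpha,\delta\in(0,1)$ and all nonnegative integers $d,m,n,r$ satisfying $r\ge 2$, $\alpha<1/(r^2+r)$, and $1\le m\le(1-\delta)\binom{n}{2}$, \[ \mathbb{P}\big(G(n,m)\notin\mathrm{CORE}_d^r(\alpha)\big)\le\frac{Cr^2}{\alpha}\cdot\left(\left(\frac{d+1}{\delta}+r\right)\cdot\sqrt{\frac{n}{m}}+\sqrt[4]{\frac{n}{m}}\right). \]
   Context: An $r$-cut in a graph $G$ is a partition of its vertex set into $r$ subsets (parts may be empty); its size is the number of edges of $G$ with endpoints in different parts. Let $b_r(G)$ be the maximum size of an $r$-cut of $G$. The deficit of an $r$-cut in $G$ is $b_r(G)$ minus its size. For integers $r\ge2$ and $d\ge0$, two vertices are $(d,r)$-equivalent in $G$ if they are in the same part of every $r$-cut in $G$ with deficit at most $d$; this is an equivalence relation on $V(G)$ whose classes are called the $(d,r)$-components of $G$. When the $r$ largest $(d,r)$-components $C_1,\dotsc,C_r$ of an $n$-vertex graph $G$ have strictly more than $n/(r+1)$ vertices each (and thus all remaining components have fewer than $n/(r+1)$ vertices), the set $\{C_1,\dotsc,C_r\}$ is called the $(d,r)$-core of $G$; otherwise $G$ has no $(d,r)$-core. $\mathrm{CORE}_d^r(\alpha)$ is the set of all graphs on $\{1,\dotsc,n\}$ that have a $(d,r)$-core each of whose components has at least $n/r-\alpha n$ vertices. $G(n,m)$ is the uniformly random graph with vertex set $\{1,\dotsc,n\}$ and exactly $m$ edges. *)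

theory Defs
  imports
    "HOL-Library.Disjoint_Sets"
    "HOL-Library.Ramsey"
    "HOL-Probability.Probability_Mass_Function"
begin

text \<open>A graph is a pair of a vertex set and a set of edges, each edge being a
  two-element set of vertices; \<^term>\<open>nsets V 2\<close> is the set of all two-element subsets of \<open>V\<close>.\<close>

type_synonym 'a graph = "'a set \<times> 'a set set"

abbreviation verts :: "'a graph \<Rightarrow> 'a set" where
  "verts G \<equiv> fst G"

abbreviation edges :: "'a graph \<Rightarrow> 'a set set" where
  "edges G \<equiv> snd G"

definition graphs_on :: "'a set \<Rightarrow> 'a graph set" where
  "graphs_on V = {G. verts G = V \<and> edges G \<subseteq> nsets V 2}"

text \<open>The parts of an \<open>r\<close>-cut are \<open>P 0, \<dots>, P (r - 1)\<close>; the values of \<open>P\<close> at other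
  indices are irrelevant. Labelling the parts changes none of the notions below,
  which depend only on the unordered partition.\<close>

definition r_cut :: "nat \<Rightarrow> 'a graph \<Rightarrow> (nat \<Rightarrow> 'a set) \<Rightarrow> bool" where
  "r_cut r G P \<longleftrightarrow> disjoint_family_on P {..<r} \<and> (\<Union>i<r. P i) = verts G"

definition cut_size :: "nat \<Rightarrow> 'a graph \<Rightarrow> (nat \<Rightarrow> 'a set) \<Rightarrow> nat" where
  "cut_size r G P =
     card {e \<in> edges G. \<exists>u v i j. e = {u, v} \<and> i < r \<and> j < r \<and> i \<noteq> j \<and> u \<in> P i \<and> v \<in> P j}"

definition max_cut :: "nat \<Rightarrow> 'a graph \<Rightarrow> nat" where
  "max_cut r G = Max {cut_size r G P | P. r_cut r G P}"

definition deficit :: "nat \<Rightarrow> 'a graph \<Rightarrow> (nat \<Rightarrow> 'a set) \<Rightarrow> int" where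
  "deficit r G P = int (max_cut r G) - int (cut_size r G P)"

definition dr_equiv :: "nat \<Rightarrow> nat \<Rightarrow> 'a graph \<Rightarrow> ('a \<times> 'a) set" where
  "dr_equiv d r G = {(u, v). u \<in> verts G \<and> v \<in> verts G \<and>
     (\<forall>P. r_cut r G P \<and> deficit r G P \<le> int d \<longrightarrow> (\<exists>i<r. u \<in> P i \<and> v \<in> P i))}"

definition dr_components :: "nat \<Rightarrow> nat \<Rightarrow> 'a graph \<Rightarrow> 'a set set" where
  "dr_components d r G = verts G // dr_equiv d r G"

text \<open>\<open>\<K>\<close> consists of the \<open>r\<close> largest components, all of them larger than \<open>n / (r + 1)\<close>.
  There is at most one such \<open>\<K>\<close> in a finite graph, since at most \<open>r\<close> disjoint
  sets of vertices can be that large.\<close>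

definition is_dr_core :: "nat \<Rightarrow> nat \<Rightarrow> 'a graph \<Rightarrow> 'a set set \<Rightarrow> bool" where
  "is_dr_core d r G \<K> \<longleftrightarrow>
     \<K> \<subseteq> dr_components d r G \<and> card \<K> = r \<and>
     (\<forall>A\<in>\<K>. \<forall>B\<in>dr_components d r G - \<K>. card B \<le> card A) \<and>
     (\<forall>A\<in>\<K>. real (card A) > real (card (verts G)) / (real r + 1))"

definition CORE :: "nat \<Rightarrow> nat \<Rightarrow> real \<Rightarrow> nat graph set" where
  "CORE d r \<alpha> = {G. \<exists>n. G \<in> graphs_on {1..n} \<and>
     (\<exists>\<K>. is_dr_core d r G \<K> \<and> (\<forall>A\<in>\<K>. real (card A) \<ge> real n / real r - \<alpha> * real n))}"

text \<open>Meaningful only for \<open>m \<le> n choose 2\<close>: otherwise no graph has \<open>m\<close> edges and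
  \<^const>\<open>pmf_of_set\<close> is unspecified.\<close>

definition Gnm :: "nat \<Rightarrow> nat \<Rightarrow> nat graph pmf" where
  "Gnm n m = pmf_of_set {G \<in> graphs_on {1..n}. card (edges G) = m}"

end

theory Submission
  imports Defs
begin

text \<open>
  Write \<open>N\<close> for the number of pairs of vertices and \<open>q = \<surd>(n/m)\<close>; one may assume \<open>q \<le> 1\<close> and
  \<open>d < \<delta>N/2\<close>, as otherwise the bound exceeds 1. Every \<open>(d, r)\<close>-component lies inside a part of any
  fixed maximum cut. The idea is to show that the number of pairs inside components is nearly
  \<open>N/r\<close>, whereas the parts of a maximum cut are nearly balanced, so that they contain hardly more
  pairs than that; then every part must be almost filled by a single component.

  Discrepancy. In the random graph, the number of edges across any cut into two parts differs
  from its expectation by \<open>O(\<surd>(n m))\<close>, uniformly over all cuts and in expectation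
  (\<open>average_cut_discrepancy_le\<close>: exponential moments of the hypergeometric distribution, and a
  sum over \<open>2\<^sup>n\<close> cuts). By averaging over random two-colourings of the parts, this extends to partitions
  into arbitrarily many parts at the cost of a factor 2 (\<open>colouring_discrepancy\<close>).

  Exchange. Remove a random edge \<open>e\<close> from a random graph \<open>S\<close> with \<open>m + 1\<close> edges; the result \<open>H\<close> is a
  random graph with \<open>m\<close> edges, and \<open>e\<close> is a random non-edge of \<open>H\<close>. If some cut of deficit at most
  \<open>d + 1\<close> separates \<open>e\<close> in \<open>H\<close>, then some cut of deficit at most \<open>d\<close> separates \<open>e\<close> in \<open>S\<close>
  (\<open>inequivalent_pairs_insert\<close>); and if some maximum cut of \<open>H\<close> separates \<open>e\<close>, then \<open>e\<close> belongs to
  every maximum cut of \<open>S\<close> (\<open>inequivalent_pairs_crossing\<close>). So the proportion of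
  \<open>(d + 1, r)\<close>-inequivalent non-edges of \<open>H\<close> is on average at most that of
  \<open>(d, r)\<close>-inequivalent edges of \<open>S\<close>, and the proportion of \<open>(0, r)\<close>-inequivalent non-edges of \<open>H\<close>
  is at most the proportion of edges in a maximum cut of \<open>S\<close>. Discrepancy allows passing between
  edges, non-edges and all pairs, so \<open>d + 1\<close> steps show that the expected proportion of
  \<open>(d, r)\<close>-inequivalent pairs is at most \<open>1 - 1/r + O((d + 1) q/\<delta>)\<close> (\<open>mean_inequivalent_le\<close>).

  Conclusion. A maximum cut contains at least \<open>(1 - 1/r) m\<close> edges, so by discrepancy it
  separates almost \<open>(1 - 1/r) N\<close> pairs and is nearly balanced (\<open>balanced_max_cut\<close>). Graphs without
  the required core have either an unbalanced maximum cut or at least of order \<open>\<alpha>n\<^sup>2/r\<close> pairs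
  inside a part but not inside a component (\<open>is_dr_core_of_balanced\<close>), and Markov's inequality bounds the
  probabilities of both events.
\<close>

section \<open>Crossing edges of a colouring\<close>

text \<open>The edges of \<open>E\<close> that are not monochromatic under the vertex colouring \<open>\<kappa>\<close>. An \<open>r\<close>-cut is
handled as a colouring with colours below \<open>r\<close>, but \<open>\<kappa>\<close> may take values in any type, so that the
classes of an equivalence relation can serve as colours, too.\<close>

definition crossing :: "('a \<Rightarrow> 'b) \<Rightarrow> 'a set set \<Rightarrow> 'a set set" where
  "crossing \<kappa> E = {e \<in> E. \<exists>u\<in>e. \<exists>v\<in>e. \<kappa> u \<noteq> \<kappa> v}"

lemma crossing_subset: "crossing \<kappa> E \<subseteq> E"
  by (auto simp: crossing_def)

lemma crossing_iff: "e \<in> crossing \<kappa> E \<longleftrightarrow> e \<in> E \<and> (\<exists>u\<in>e. \<exists>v\<in>e. \<kappa> u \<noteq> \<kappa> v)"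
  by (simp add: crossing_def)

lemma crossing_Int: "E \<subseteq> F \<Longrightarrow> crossing \<kappa> E = E \<inter> crossing \<kappa> F"
  by (auto simp: crossing_def)

lemma crossing_cong:
  assumes "\<And>e u v. e \<in> E \<Longrightarrow> u \<in> e \<Longrightarrow> v \<in> e \<Longrightarrow> \<kappa> u = \<kappa> v \<longleftrightarrow> \<kappa>' u = \<kappa>' v"
  shows "crossing \<kappa> E = crossing \<kappa>' E"
proof -
  have "(\<exists>u\<in>e. \<exists>v\<in>e. \<kappa> u \<noteq> \<kappa> v) \<longleftrightarrow> (\<exists>u\<in>e. \<exists>v\<in>e. \<kappa>' u \<noteq> \<kappa>' v)" if "e \<in> E" for e
    by (intro bex_cong refl) (simp only: assms[OF that])
  thus ?thesis unfolding crossing_def by (intro Collect_cong conj_cong refl)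
qed

lemma card_crossing_insert:
  assumes "finite E" "e \<notin> E"
  shows "\<exists>u\<in>e. \<exists>v\<in>e. \<kappa> u \<noteq> \<kappa> v \<Longrightarrow> card (crossing \<kappa> (insert e E)) = card (crossing \<kappa> E) + 1"
    and "\<not> (\<exists>u\<in>e. \<exists>v\<in>e. \<kappa> u \<noteq> \<kappa> v) \<Longrightarrow> card (crossing \<kappa> (insert e E)) = card (crossing \<kappa> E)"
proof -
  have fin: "finite (crossing \<kappa> E)" "e \<notin> crossing \<kappa> E"
    using assms by (simp_all add: crossing_def)
  show "card (crossing \<kappa> (insert e E)) = card (crossing \<kappa> E) + 1"
    if "\<exists>u\<in>e. \<exists>v\<in>e. \<kappa> u \<noteq> \<kappa> v"
  proof -
    have "crossing \<kappa> (insert e E) = insert e (crossing \<kappa> E)"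
      using that unfolding crossing_def by blast
    thus ?thesis using fin by simp
  qed
  show "card (crossing \<kappa> (insert e E)) = card (crossing \<kappa> E)"
    if "\<not> (\<exists>u\<in>e. \<exists>v\<in>e. \<kappa> u \<noteq> \<kappa> v)"
  proof -
    have "crossing \<kappa> (insert e E) = crossing \<kappa> E"
      using that unfolding crossing_def by blast
    thus ?thesis by (rule arg_cong)
  qed
qed

text \<open>Among all maps \<open>K \<rightarrow> {..<r}\<close>, a proportion of \<open>1 - 1/r\<close> separates two given distinct points.\<close>

lemma card_maps_separating:
  assumes "finite K" "a \<in> K" "b \<in> K" "a \<noteq> b"
  shows "r * card {f \<in> K \<rightarrow>\<^sub>E {..<r}. f a \<noteq> f b} = (r - 1) * r ^ card K"
proof -
  let ?F = "K \<rightarrow>\<^sub>E {..<r}"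
  let ?eq = "{f \<in> ?F. f a = f b}"
  have fin: "finite ?F" using assms by (intro finite_PiE) auto
  have "bij_betw (\<lambda>f. restrict f (K - {a})) ?eq ((K - {a}) \<rightarrow>\<^sub>E {..<r})"
  proof (rule bij_betw_byWitness[where f' = "\<lambda>g. g(a := g b)"])
    show "\<forall>f\<in>?eq. (restrict f (K - {a}))(a := restrict f (K - {a}) b) = f"
      using assms by (auto simp: fun_eq_iff PiE_def extensional_def)
    show "\<forall>g\<in>(K - {a}) \<rightarrow>\<^sub>E {..<r}. restrict (g(a := g b)) (K - {a}) = g"
      by (auto simp: fun_eq_iff PiE_def extensional_def)
    show "(\<lambda>f. restrict f (K - {a})) ` ?eq \<subseteq> (K - {a}) \<rightarrow>\<^sub>E {..<r}"
      by (auto simp: PiE_def Pi_def)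
    show "(\<lambda>g. g(a := g b)) ` ((K - {a}) \<rightarrow>\<^sub>E {..<r}) \<subseteq> ?eq"
      using assms by (auto simp: PiE_def Pi_def extensional_def)
  qed
  hence "card ?eq = card ((K - {a}) \<rightarrow>\<^sub>E {..<r})" by (rule bij_betw_same_card)
  also have "\<dots> = r ^ (card K - 1)" using assms by (simp add: card_PiE)
  finally have eq: "r * card ?eq = r ^ card K"
    using assms by (metis card_gt_0_iff empty_iff power_eq_if not_gr_zero)
  have "?F = ?eq \<union> {f \<in> ?F. f a \<noteq> f b}" by auto
  moreover have "card (?eq \<union> {f \<in> ?F. f a \<noteq> f b}) = card ?eq + card {f \<in> ?F. f a \<noteq> f b}"
    using fin by (intro card_Un_disjoint) auto
  ultimately have "card ?F = card ?eq + card {f \<in> ?F. f a \<noteq> f b}" by simp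
  moreover have "card ?F = r ^ card K" using assms by (simp add: card_PiE)
  ultimately have "card {f \<in> ?F. f a \<noteq> f b} = r ^ card K - card ?eq"
    by linarith
  hence "r * card {f \<in> ?F. f a \<noteq> f b} = r * r ^ card K - r * card ?eq"
    by (simp add: diff_mult_distrib2)
  thus ?thesis using eq by (simp add: diff_mult_distrib)
qed

text \<open>Recolouring the colours of \<open>\<kappa>\<close> at random with \<open>r\<close> new ones keeps an edge that crosses \<open>\<kappa>\<close>
crossing with probability \<open>1 - 1/r\<close>. With \<open>\<kappa> = id\<close> this gives a large \<open>r\<close>-cut; with \<open>r = 2\<close> it
reduces arbitrary partitions to cuts into two parts.\<close>

lemma sum_card_crossing_comp:
  assumes "finite V" "finite K" "\<kappa> ` V \<subseteq> K" "E \<subseteq> nsets V 2"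
  shows "r * (\<Sum>f \<in> K \<rightarrow>\<^sub>E {..<r}. card (crossing (f \<circ> \<kappa>) E)) =
    (r - 1) * r ^ card K * card (crossing \<kappa> E)"
proof -
  let ?F = "K \<rightarrow>\<^sub>E {..<r}"
  have finF: "finite ?F" using assms by (intro finite_PiE) auto
  have finE: "finite E" using assms finite_imp_finite_nsets finite_subset by metis
  have "(\<Sum>f\<in>?F. card (crossing (f \<circ> \<kappa>) E)) =
      (\<Sum>f\<in>?F. \<Sum>e\<in>E. of_bool (\<exists>u\<in>e. \<exists>v\<in>e. f (\<kappa> u) \<noteq> f (\<kappa> v)))"
    using finE by (simp add: crossing_def sum_of_bool_eq Int_def)
  also have "\<dots> = (\<Sum>e\<in>E. \<Sum>f\<in>?F. of_bool (\<exists>u\<in>e. \<exists>v\<in>e. f (\<kappa> u) \<noteq> f (\<kappa> v)))"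
    by (rule sum.swap)
  also have "\<dots> = (\<Sum>e\<in>E. card {f\<in>?F. \<exists>u\<in>e. \<exists>v\<in>e. f (\<kappa> u) \<noteq> f (\<kappa> v)})"
    using finF by (simp add: sum_of_bool_eq Int_def)
  finally have "r * (\<Sum>f\<in>?F. card (crossing (f \<circ> \<kappa>) E)) =
      (\<Sum>e\<in>E. r * card {f\<in>?F. \<exists>u\<in>e. \<exists>v\<in>e. f (\<kappa> u) \<noteq> f (\<kappa> v)})"
    by (simp add: sum_distrib_left)
  also have "\<dots> = (\<Sum>e\<in>E. (r - 1) * r ^ card K * of_bool (\<exists>u\<in>e. \<exists>v\<in>e. \<kappa> u \<noteq> \<kappa> v))"
  proof (rule sum.cong[OF refl])
    fix e assume "e \<in> E"
    then obtain u v where e: "e = {u, v}" "u \<in> V" "v \<in> V"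
      using assms(4) by (metis nsets2_E subsetD)
    show "r * card {f\<in>?F. \<exists>u\<in>e. \<exists>v\<in>e. f (\<kappa> u) \<noteq> f (\<kappa> v)} =
        (r - 1) * r ^ card K * of_bool (\<exists>u\<in>e. \<exists>v\<in>e. \<kappa> u \<noteq> \<kappa> v)"
    proof (cases "\<kappa> u = \<kappa> v")
      case True
      thus ?thesis by (simp add: e)
    next
      case False
      have "{f\<in>?F. \<exists>u\<in>e. \<exists>v\<in>e. f (\<kappa> u) \<noteq> f (\<kappa> v)} = {f\<in>?F. f (\<kappa> u) \<noteq> f (\<kappa> v)}"
        by (auto simp: e)
      moreover have "r * card {f\<in>?F. f (\<kappa> u) \<noteq> f (\<kappa> v)} = (r - 1) * r ^ card K"
        using False e assms by (intro card_maps_separating) auto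
      ultimately show ?thesis using False by (auto simp: e)
    qed
  qed
  also have "\<dots> = (r - 1) * r ^ card K * card (crossing \<kappa> E)"
    using finE by (simp add: crossing_def sum_of_bool_eq Int_def flip: sum_distrib_left)
  finally show ?thesis .
qed

lemma exists_large_cut:
  assumes "finite V" "E \<subseteq> nsets V 2" "r \<ge> 1"
  shows "\<exists>f \<in> V \<rightarrow>\<^sub>E {..<r}. (r - 1) * card E \<le> r * card (crossing f E)"
proof (rule ccontr)
  let ?F = "V \<rightarrow>\<^sub>E {..<r}"
  assume "\<not> ?thesis"
  hence "\<And>f. f \<in> ?F \<Longrightarrow> r * card (crossing f E) < (r - 1) * card E" by force
  moreover have "finite ?F" using assms by (intro finite_PiE) auto
  moreover have cF: "card ?F = r ^ card V" using assms by (simp add: card_PiE)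
  hence "?F \<noteq> {}" using assms by force
  ultimately have "(\<Sum>f\<in>?F. r * card (crossing f E)) < (\<Sum>f\<in>?F. (r - 1) * card E)"
    by (intro sum_strict_mono) auto
  moreover have "\<exists>u\<in>e. \<exists>v\<in>e. u \<noteq> v" if "e \<in> E" for e
  proof -
    have "e \<in> nsets V 2" using assms(2) that by auto
    thus ?thesis by (elim nsets2_E) auto
  qed
  hence "crossing id E = E" by (auto simp: crossing_def)
  ultimately show False
    using sum_card_crossing_comp[of V V id E r] assms cF
    by (simp add: sum_distrib_left)
qed

section \<open>Discrepancy of cuts and colourings\<close>

text \<open>The largest deviation, over all cuts of \<open>V\<close> into two parts \<open>X\<close> and \<open>V - X\<close>, between the number of
crossing edges and the number expected from the edge density of \<open>E\<close>.\<close>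

definition cut_discrepancy :: "'a set \<Rightarrow> 'a set set \<Rightarrow> real" where
  "cut_discrepancy V E = Max ((\<lambda>X. \<bar>real (card (crossing (\<lambda>v. v \<in> X) E)) -
     real (card E) / real (card (nsets V 2)) *
     real (card (crossing (\<lambda>v. v \<in> X) (nsets V 2)))\<bar>) ` Pow V)"

lemma cut_discrepancy_upper:
  assumes "finite V" "X \<subseteq> V"
  shows "\<bar>real (card (crossing (\<lambda>v. v \<in> X) E)) -
     real (card E) / real (card (nsets V 2)) *
     real (card (crossing (\<lambda>v. v \<in> X) (nsets V 2)))\<bar> \<le> cut_discrepancy V E"
  unfolding cut_discrepancy_def using assms by (intro Max_ge) auto

lemma cut_discrepancy_nonneg:
  assumes "finite V" shows "0 \<le> cut_discrepancy V E"
  by (rule order_trans[OF abs_ge_zero cut_discrepancy_upper[OF assms empty_subsetI]])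

text \<open>Partitions into any number of parts deviate by at most twice the discrepancy of cuts into two
parts. The bound does not depend on the number of parts; this matters because the
\<open>(d, r)\<close>-components may be numerous, and a union bound over all partitions would lose a logarithm.\<close>

lemma colouring_discrepancy:
  assumes "finite V" "E \<subseteq> nsets V 2"
  shows "\<bar>real (card (crossing \<kappa> E)) -
     real (card E) / real (card (nsets V 2)) * real (card (crossing \<kappa> (nsets V 2)))\<bar>
     \<le> 2 * cut_discrepancy V E"
proof -
  define K where "K = \<kappa> ` V"
  let ?F = "K \<rightarrow>\<^sub>E {..<2::nat}" and ?U = "nsets V 2"
  let ?p = "real (card E) / real (card ?U)" and ?D = "cut_discrepancy V E"
  have finK: "finite K" using assms by (simp add: K_def)
  have cF: "card ?F = 2 ^ card K" using finK by (simp add: card_PiE)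
  have sum: "2 * (\<Sum>f\<in>?F. real (card (crossing (f \<circ> \<kappa>) G))) = 2 ^ card K * real (card (crossing \<kappa> G))"
    if "G \<subseteq> ?U" for G
    using arg_cong[OF sum_card_crossing_comp[OF assms(1) finK _ that, of \<kappa> 2], of real]
    by (simp add: K_def)
  have bd: "\<bar>real (card (crossing (f \<circ> \<kappa>) E)) - ?p * real (card (crossing (f \<circ> \<kappa>) ?U))\<bar> \<le> ?D"
    if f: "f \<in> ?F" for f
  proof -
    \<comment> \<open>A two-colouring of the colours is a cut of \<open>V\<close> into two parts.\<close>
    let ?X = "{v \<in> V. f (\<kappa> v) = 0}"
    have two: "f (\<kappa> v) = 0 \<or> f (\<kappa> v) = 1" if "v \<in> V" for v
      using f that PiE_mem[OF f, of "\<kappa> v"] by (auto simp: K_def)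
    have "crossing (f \<circ> \<kappa>) G = crossing (\<lambda>v. v \<in> ?X) G" if "G \<subseteq> ?U" for G
    proof (rule crossing_cong)
      fix e u v assume "e \<in> G" "u \<in> e" "v \<in> e"
      hence "u \<in> V" "v \<in> V" using that by (auto simp: nsets_def)
      thus "(f \<circ> \<kappa>) u = (f \<circ> \<kappa>) v \<longleftrightarrow> (u \<in> ?X) = (v \<in> ?X)"
        using two[of u] two[of v] by auto
    qed
    thus ?thesis using cut_discrepancy_upper[of V ?X E] assms by simp
  qed
  let ?x = "\<lambda>f. real (card (crossing (f \<circ> \<kappa>) E))" and ?y = "\<lambda>f. real (card (crossing (f \<circ> \<kappa>) ?U))"
  let ?d = "real (card (crossing \<kappa> E)) - ?p * real (card (crossing \<kappa> ?U))"
  have "(\<Sum>f\<in>?F. ?x f - ?p * ?y f) = (\<Sum>f\<in>?F. ?x f) - ?p * (\<Sum>f\<in>?F. ?y f)"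
    by (simp only: sum_subtractf sum_distrib_left)
  hence "2 * (\<Sum>f\<in>?F. ?x f - ?p * ?y f) = 2 * (\<Sum>f\<in>?F. ?x f) - ?p * (2 * (\<Sum>f\<in>?F. ?y f))"
    by (simp only: right_diff_distrib mult.left_commute)
  also have "\<dots> = 2 ^ card K * ?d"
    unfolding sum[OF assms(2)] sum[OF order_refl] by (simp only: right_diff_distrib mult.left_commute)
  finally have "2 ^ card K * \<bar>?d\<bar> = 2 * \<bar>\<Sum>f\<in>?F. ?x f - ?p * ?y f\<bar>"
    using abs_mult_pos'[of "2 ^ card K" ?d] abs_mult_pos'[of 2 "\<Sum>f\<in>?F. ?x f - ?p * ?y f"] by simp
  also have "\<dots> \<le> 2 * (\<Sum>f\<in>?F. \<bar>?x f - ?p * ?y f\<bar>)"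
    by (intro mult_left_mono sum_abs) auto
  also have "\<dots> \<le> 2 * (\<Sum>f\<in>?F. ?D)"
    by (intro mult_left_mono sum_mono bd) auto
  also have "\<dots> = 2 ^ card K * (2 * ?D)" using cF by simp
  finally show ?thesis by (rule mult_left_le_imp_le) simp
qed

section \<open>Finite averages\<close>

text \<open>The mean of \<open>f\<close> over a finite set of equally likely outcomes.\<close>

definition average :: "'b set \<Rightarrow> ('b \<Rightarrow> real) \<Rightarrow> real" where
  "average \<Omega> f = (\<Sum>\<omega>\<in>\<Omega>. f \<omega>) / real (card \<Omega>)"

lemma average_mono: "(\<And>\<omega>. \<omega> \<in> \<Omega> \<Longrightarrow> f \<omega> \<le> g \<omega>) \<Longrightarrow> average \<Omega> f \<le> average \<Omega> g"
  unfolding average_def by (intro divide_right_mono sum_mono) auto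

lemma average_add: "average \<Omega> (\<lambda>\<omega>. f \<omega> + g \<omega>) = average \<Omega> f + average \<Omega> g"
  by (simp add: average_def sum.distrib add_divide_distrib)

lemma average_cmult: "average \<Omega> (\<lambda>\<omega>. c * f \<omega>) = c * average \<Omega> f"
  by (simp add: average_def flip: sum_distrib_left)

lemma average_divide: "average \<Omega> (\<lambda>\<omega>. f \<omega> / c) = average \<Omega> f / c"
  by (simp add: average_def flip: sum_divide_distrib)

lemma average_const: "finite \<Omega> \<Longrightarrow> \<Omega> \<noteq> {} \<Longrightarrow> average \<Omega> (\<lambda>_. c) = c"
  by (simp add: average_def)

lemma average_sum: "average \<Omega> (\<lambda>\<omega>. \<Sum>i\<in>I. f i \<omega>) = (\<Sum>i\<in>I. average \<Omega> (f i))"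
  unfolding average_def by (subst sum.swap) (simp add: sum_divide_distrib)

lemma average_markov:
  assumes "finite \<Omega>" "\<And>\<omega>. \<omega> \<in> \<Omega> \<Longrightarrow> 0 \<le> f \<omega>" "t > 0"
  shows "real (card {\<omega> \<in> \<Omega>. t \<le> f \<omega>}) / real (card \<Omega>) \<le> average \<Omega> f / t"
proof -
  have "t * real (card {\<omega> \<in> \<Omega>. t \<le> f \<omega>}) = (\<Sum>\<omega>\<in>{\<omega> \<in> \<Omega>. t \<le> f \<omega>}. t)" by simp
  also have "\<dots> \<le> (\<Sum>\<omega>\<in>{\<omega> \<in> \<Omega>. t \<le> f \<omega>}. f \<omega>)" by (intro sum_mono) auto
  also have "\<dots> \<le> (\<Sum>\<omega>\<in>\<Omega>. f \<omega>)" using assms by (intro sum_mono2) auto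
  finally have "real (card {\<omega> \<in> \<Omega>. t \<le> f \<omega>}) \<le> (\<Sum>\<omega>\<in>\<Omega>. f \<omega>) / t"
    using assms(3) by (simp add: field_simps)
  hence "real (card {\<omega> \<in> \<Omega>. t \<le> f \<omega>}) / real (card \<Omega>) \<le> (\<Sum>\<omega>\<in>\<Omega>. f \<omega>) / t / real (card \<Omega>)"
    by (rule divide_right_mono) simp
  thus ?thesis unfolding average_def by (simp add: mult.commute)
qed

text \<open>Jensen's inequality for \<open>exp\<close>, from the tangent of \<open>exp\<close> at \<open>c\<close>.\<close>

lemma average_exp_jensen:
  assumes "finite \<Omega>" "\<Omega> \<noteq> {}" "average \<Omega> (\<lambda>\<omega>. exp (f \<omega>)) \<le> exp c"
  shows "average \<Omega> f \<le> c"
proof -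
  have "average \<Omega> f \<le> average \<Omega> (\<lambda>\<omega>. c - 1 + exp (- c) * exp (f \<omega>))"
  proof (rule average_mono)
    fix \<omega>
    show "f \<omega> \<le> c - 1 + exp (- c) * exp (f \<omega>)"
      using exp_ge_add_one_self[of "f \<omega> - c"] by (simp add: exp_diff exp_minus field_simps)
  qed
  also have "\<dots> = c - 1 + exp (- c) * average \<Omega> (\<lambda>\<omega>. exp (f \<omega>))"
    using assms by (simp add: average_add average_cmult average_const)
  also have "\<dots> \<le> c - 1 + exp (- c) * exp c"
    using assms by (intro add_mono mult_left_mono) auto
  also have "\<dots> = c" by (simp flip: exp_add)
  finally show ?thesis .
qed

lemma average_sqrt_le:
  assumes "finite \<Omega>" "\<Omega> \<noteq> {}" "\<And>\<omega>. \<omega> \<in> \<Omega> \<Longrightarrow> 0 \<le> f \<omega>" "average \<Omega> f \<le> c" "0 < c"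
  shows "average \<Omega> (\<lambda>\<omega>. sqrt (f \<omega>)) \<le> sqrt c"
proof -
  \<comment> \<open>The tangent of the square root at \<open>c\<close> lies above its graph.\<close>
  have "average \<Omega> (\<lambda>\<omega>. sqrt (f \<omega>)) \<le> average \<Omega> (\<lambda>\<omega>. (sqrt c + f \<omega> / sqrt c) / 2)"
  proof (rule average_mono)
    fix \<omega> assume "\<omega> \<in> \<Omega>"
    hence "sqrt (f \<omega>) * (2 * sqrt c) \<le> c + f \<omega>"
      using sum_squares_bound[of "sqrt (f \<omega>)" "sqrt c"] assms by (simp add: mult_ac)
    thus "sqrt (f \<omega>) \<le> (sqrt c + f \<omega> / sqrt c) / 2"
      using assms by (simp add: field_simps)
  qed
  also have "\<dots> = (sqrt c + average \<Omega> f / sqrt c) / 2"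
    using assms by (simp add: average_divide average_add average_const)
  also have "\<dots> \<le> (sqrt c + c / sqrt c) / 2"
    using assms by (intro divide_right_mono add_left_mono) auto
  also have "\<dots> = sqrt c" using assms by (simp add: real_div_sqrt)
  finally show ?thesis .
qed

section \<open>Exponential moments of random subsets\<close>

lemma card_nsets_superset:
  assumes "finite U" "T \<subseteq> U" "card T \<le> m"
  shows "card {S \<in> nsets U m. T \<subseteq> S} = (card U - card T) choose (m - card T)"
proof -
  have finT: "finite T" using assms finite_subset by auto
  have "bij_betw (\<lambda>S. S - T) {S \<in> nsets U m. T \<subseteq> S} (nsets (U - T) (m - card T))"
  proof (rule bij_betw_byWitness[where f' = "\<lambda>S. S \<union> T"])
    show "(\<lambda>S. S - T) ` {S \<in> nsets U m. T \<subseteq> S} \<subseteq> nsets (U - T) (m - card T)"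
      using finT by (auto simp: nsets_def card_Diff_subset)
    show "(\<lambda>S. S \<union> T) ` nsets (U - T) (m - card T) \<subseteq> {S \<in> nsets U m. T \<subseteq> S}"
    proof clarify
      fix S assume S: "S \<in> nsets (U - T) (m - card T)"
      hence "card (S \<union> T) = card S + card T"
        using finT by (intro card_Un_disjoint) (auto simp: nsets_def)
      thus "S \<union> T \<in> nsets U m \<and> T \<subseteq> S \<union> T"
        using S assms finT by (auto simp: nsets_def)
    qed
  qed (auto simp: nsets_def)
  hence "card {S \<in> nsets U m. T \<subseteq> S} = card (nsets (U - T) (m - card T))"
    by (rule bij_betw_same_card)
  thus ?thesis using assms finT by (simp add: card_Diff_subset)
qed

text \<open>A fixed set of \<open>j\<close> elements lies in a random \<open>m\<close>-subset of \<open>N\<close> elements with probability at most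
\<open>(m/N)\<^sup>j\<close>.\<close>

lemma binomial_shift_le:
  assumes "j \<le> m" "m \<le> N" "N > 0"
  shows "real ((N - j) choose (m - j)) \<le> (real m / real N) ^ j * real (N choose m)"
  using assms(1)
proof (induction j)
  case (Suc j)
  have "Suc (m - Suc j) * (Suc (N - Suc j) choose Suc (m - Suc j)) =
      Suc (N - Suc j) * ((N - Suc j) choose (m - Suc j))"
    by (rule Suc_times_binomial)
  moreover have "Suc (m - Suc j) = m - j" "Suc (N - Suc j) = N - j"
    using Suc.prems assms by auto
  ultimately have "(m - j) * ((N - j) choose (m - j)) = (N - j) * ((N - Suc j) choose (m - Suc j))"
    by simp
  hence eq: "real (m - j) * real ((N - j) choose (m - j)) =
      real (N - j) * real ((N - Suc j) choose (m - Suc j))"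
    by (simp only: flip: of_nat_mult)
  have pos: "real (N - j) > 0" using Suc.prems assms by simp
  have "real (m - j) / real (N - j) \<le> real m / real N"
    using Suc.prems assms mult_right_mono[of "real m" "real N" "real j"] by (simp add: field_simps of_nat_diff)
  hence "real (m - j) / real (N - j) * real ((N - j) choose (m - j)) \<le>
      real m / real N * ((real m / real N) ^ j * real (N choose m))"
    using Suc by (intro mult_mono) auto
  moreover have "real ((N - Suc j) choose (m - Suc j)) =
      real (m - j) / real (N - j) * real ((N - j) choose (m - j))"
    using eq pos by (simp add: field_simps)
  ultimately show ?case by simp
qed simp

text \<open>The probability generating function of a hypergeometric variable, at arguments \<open>1 + x\<close> with
\<open>x \<ge> 0\<close>, is at most that of the binomial variable with the same mean: expand in powers of \<open>x\<close>
and compare factorial moments.\<close>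

lemma average_hypergeometric_mgf:
  fixes x :: real
  assumes "finite U" "A \<subseteq> U" "m \<le> card U" "card U > 0" "x \<ge> 0"
  shows "average (nsets U m) (\<lambda>S. (1 + x) ^ card (S \<inter> A)) \<le> (1 + x * (real m / real (card U))) ^ card A"
proof -
  let ?N = "card U" and ?C = "real (card U choose m)"
  have finA: "finite A" using assms finite_subset by auto
  have finn: "finite (nsets U m)" using assms finite_imp_finite_nsets by auto
  have subsets: "(\<Sum>T\<in>Pow B. y ^ card T) = (1 + y) ^ card B" if "finite B" for B :: "'a set" and y :: real
    using prod_add[OF that, of "\<lambda>_. y" "\<lambda>_. 1"] by (simp add: add.commute)
  have "(\<Sum>S\<in>nsets U m. (1 + x) ^ card (S \<inter> A)) = (\<Sum>S\<in>nsets U m. \<Sum>T\<in>Pow (S \<inter> A). x ^ card T)"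
    using finA by (intro sum.cong refl subsets[symmetric]) auto
  also have "\<dots> = (\<Sum>S\<in>nsets U m. \<Sum>T\<in>{T \<in> Pow A. T \<subseteq> S}. x ^ card T)"
    by (intro sum.cong refl) auto
  also have "\<dots> = (\<Sum>T\<in>Pow A. \<Sum>S\<in>{S \<in> nsets U m. T \<subseteq> S}. x ^ card T)"
    using finn finA by (intro sum.swap_restrict) auto
  also have "\<dots> \<le> (\<Sum>T\<in>Pow A. (x * (real m / real ?N)) ^ card T * ?C)"
  proof (rule sum_mono)
    fix T assume "T \<in> Pow A"
    hence T: "T \<subseteq> U" using assms by auto
    show "(\<Sum>S\<in>{S \<in> nsets U m. T \<subseteq> S}. x ^ card T) \<le> (x * (real m / real ?N)) ^ card T * ?C"
    proof (cases "card T \<le> m")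
      case True
      have "real (card {S \<in> nsets U m. T \<subseteq> S}) \<le> (real m / real ?N) ^ card T * ?C"
        using binomial_shift_le[OF True assms(3,4)] card_nsets_superset[OF assms(1) T True] by simp
      hence "x ^ card T * real (card {S \<in> nsets U m. T \<subseteq> S}) \<le> x ^ card T * ((real m / real ?N) ^ card T * ?C)"
        using assms by (intro mult_left_mono) auto
      thus ?thesis by (simp add: power_mult_distrib mult_ac power_divide)
    next
      case False
      have "card T \<le> m" if "S \<in> nsets U m" "T \<subseteq> S" for S
        using that card_mono[of S T] by (auto simp: nsets_def)
      hence "{S \<in> nsets U m. T \<subseteq> S} = {}" using False by auto
      thus ?thesis using assms by (metis (no_types, lifting) divide_nonneg_nonneg mult_nonneg_nonneg of_nat_0_le_iff sum.empty zero_le_power)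
    qed
  qed
  also have "\<dots> = ?C * (1 + x * (real m / real ?N)) ^ card A"
    using subsets[OF finA, of "x * (real m / real ?N)"] by (simp add: mult.commute flip: sum_distrib_left)
  finally show ?thesis
    using assms unfolding average_def by (simp add: field_simps)
qed

text \<open>Exponential moment of the upper deviation, with parameter \<open>ln (1 + x)\<close>.\<close>

lemma average_hypergeometric_exp:
  fixes x :: real
  assumes "finite U" "A \<subseteq> U" "m \<le> card U" "card U > 0" "0 \<le> x" "x \<le> 1"
  shows "average (nsets U m) (\<lambda>S. exp (ln (1 + x) * (real (card (S \<inter> A)) - real m / real (card U) * real (card A))))
    \<le> exp (real m * x\<^sup>2)"
proof -
  define p where "p = real m / real (card U)"
  define s where "s = ln (1 + x)"
  define a where "a = real (card A)"
  have p: "p \<ge> 0" by (simp add: p_def)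
  have "card A \<le> card U" using assms card_mono by blast
  hence "p * a \<le> p * real (card U)" using p by (intro mult_left_mono) (auto simp: a_def)
  also have "\<dots> = m" using assms by (auto simp: p_def)
  finally have pa: "p * a \<le> m" .
  have "exp (s * (real k - p * a)) = (1 + x) ^ k * exp (- s * (p * a))" for k
  proof -
    have "exp (s * (real k - p * a)) = exp (real k * s) * exp (- s * (p * a))"
      by (simp add: algebra_simps flip: exp_add)
    also have "exp (real k * s) = (1 + x) ^ k"
      using assms by (simp add: exp_of_nat_mult s_def)
    finally show ?thesis .
  qed
  hence "average (nsets U m) (\<lambda>S. exp (s * (real (card (S \<inter> A)) - p * a))) =
      exp (- s * (p * a)) * average (nsets U m) (\<lambda>S. (1 + x) ^ card (S \<inter> A))"
    by (simp add: mult.commute flip: average_cmult)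
  also have "\<dots> \<le> exp (- s * (p * a)) * (1 + x * p) ^ card A"
    unfolding p_def using assms by (intro mult_left_mono average_hypergeometric_mgf) auto
  also have "\<dots> \<le> exp (- s * (p * a)) * exp (x * p) ^ card A"
    using assms p by (intro mult_left_mono power_mono exp_ge_add_one_self) auto
  also have "\<dots> = exp ((x - s) * (p * a))"
    by (simp add: a_def algebra_simps flip: exp_of_nat_mult exp_add)
  also have "\<dots> \<le> exp (m * x\<^sup>2)"
  proof -
    have "x - s \<le> x\<^sup>2"
      using ln_one_plus_pos_lower_bound[of x] assms by (simp add: s_def)
    hence "(x - s) * (p * a) \<le> x\<^sup>2 * m"
      using pa p by (intro mult_mono) (auto simp: a_def)
    thus ?thesis by (simp add: mult.commute)
  qed
  finally show ?thesis by (simp add: p_def s_def a_def)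
qed

text \<open>A random graph with \<open>n\<close> vertices and \<open>m \<ge> n\<close> edges has expected discrepancy \<open>O(\<surd>(n m))\<close>. The
exponential of the discrepancy is bounded by a sum over all \<open>2\<^sup>n\<close> cuts and both signs of the
deviation; the parameter \<open>x\<close> below makes \<open>m x\<^sup>2\<close> comparable to \<open>n\<close>, the logarithm of the number of
cuts. Only upper deviations need an estimate, since a lower deviation for a set of pairs is an
upper deviation for its complement.\<close>

lemma average_cut_discrepancy_le:
  fixes V :: "'a set"
  assumes "finite V" "card V \<ge> 1" "card V \<le> m" "m \<le> card (nsets V 2)"
  shows "average (nsets (nsets V 2) m) (cut_discrepancy V) \<le> 9 * sqrt (real (card V) * real m)"
proof -
  define U where "U = nsets V 2"
  define n where "n = card V"
  define p where "p = real m / real (card U)"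
  define x where "x = sqrt (real n / real m) / 2"
  define s where "s = ln (1 + x)"
  define y where "y = (\<lambda>(S :: 'a set set) A. real (card (S \<inter> A)) - p * real (card A))"
  have m: "m > 0" "n > 0" "n \<le> m" using assms by (auto simp: n_def)
  have x: "0 < x" "x \<le> 1 / 2" using m by (auto simp: x_def)
  have "x * x \<le> x * (1 / 2)" using x by (intro mult_left_mono) auto
  hence s: "s \<ge> x / 2"
    using ln_one_plus_pos_lower_bound[of x] x unfolding s_def power2_eq_square by linarith
  have s0: "s > 0" using s x by linarith
  have finU: "finite U" using assms finite_imp_finite_nsets unfolding U_def by blast
  have N: "card U > 0" "m \<le> card U" using assms m unfolding U_def by linarith+
  have fin: "finite (nsets U m)" using finU finite_imp_finite_nsets by blast
  have ne: "nsets U m \<noteq> {}" using N finU by (simp add: nsets_eq_empty_iff)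
  define A where "A = (\<lambda>X. crossing (\<lambda>v. v \<in> X) U)"
  have A: "A X \<subseteq> U" for X unfolding A_def by (rule crossing_subset)
  have expA: "average (nsets U m) (\<lambda>S. exp (s * y S B)) \<le> exp (real m * x\<^sup>2)" if "B \<subseteq> U" for B
    using average_hypergeometric_exp[OF finU that N(2,1), of x] x by (simp add: s_def y_def p_def)
  have "average (nsets U m) (\<lambda>S. exp (s * cut_discrepancy V S)) \<le>
      average (nsets U m) (\<lambda>S. \<Sum>X\<in>Pow V. exp (s * y S (A X)) + exp (s * y S (U - A X)))"
  proof (rule average_mono)
    fix S assume S: "S \<in> nsets U m"
    hence SU: "S \<subseteq> U" "card S = m" "finite S" by (auto simp: nsets_def)
    have "cut_discrepancy V S \<in> (\<lambda>X. \<bar>real (card (crossing (\<lambda>v. v \<in> X) S)) -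
        real (card S) / real (card (nsets V 2)) * real (card (crossing (\<lambda>v. v \<in> X) (nsets V 2)))\<bar>) ` Pow V"
      unfolding cut_discrepancy_def using assms by (intro Max_in) auto
    then obtain X where X: "X \<in> Pow V" and "cut_discrepancy V S =
        \<bar>real (card (crossing (\<lambda>v. v \<in> X) S)) - p * real (card (A X))\<bar>"
      unfolding p_def A_def U_def[symmetric] SU(2) by (elim imageE)
    hence d: "cut_discrepancy V S = \<bar>y S (A X)\<bar>"
      using crossing_Int[OF SU(1), of "\<lambda>v. v \<in> X"] by (simp add: y_def A_def)
    have "card (S \<inter> A X) + card (S \<inter> (U - A X)) = card ((S \<inter> A X) \<union> (S \<inter> (U - A X)))"
      using SU by (intro card_Un_disjoint[symmetric]) auto
    also have "(S \<inter> A X) \<union> (S \<inter> (U - A X)) = S" using SU by auto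
    finally have "real (card (S \<inter> A X)) + real (card (S \<inter> (U - A X))) = m"
      using SU(2) by (simp flip: of_nat_add)
    moreover have "real (card (U - A X)) = real (card U) - real (card (A X))"
      using A[of X] finU card_mono[OF finU A[of X]] by (simp add: card_Diff_subset finite_subset of_nat_diff)
    hence "p * real (card (U - A X)) = m - p * real (card (A X))"
      using N by (simp add: p_def right_diff_distrib)
    ultimately have "y S (U - A X) = - y S (A X)" by (simp add: y_def)
    hence "exp (s * cut_discrepancy V S) \<le> exp (s * y S (A X)) + exp (s * y S (U - A X))"
      unfolding d by (cases "y S (A X) \<ge> 0") auto
    also have "\<dots> \<le> (\<Sum>X\<in>Pow V. exp (s * y S (A X)) + exp (s * y S (U - A X)))"
      using X assms by (intro member_le_sum[where f = "\<lambda>X. exp (s * y S (A X)) + exp (s * y S (U - A X))"]) 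
        (auto intro: add_nonneg_nonneg)
    finally show "exp (s * cut_discrepancy V S) \<le> \<dots>" .
  qed
  also have "\<dots> \<le> (\<Sum>X\<in>Pow V. exp (real m * x\<^sup>2) + exp (real m * x\<^sup>2))"
    unfolding average_sum average_add using A by (intro sum_mono add_mono expA) auto
  also have "\<dots> = 2 ^ (n + 1) * exp (real m * x\<^sup>2)"
    using assms by (simp add: card_Pow n_def)
  also have "\<dots> \<le> exp 1 ^ (n + 1) * exp (real m * x\<^sup>2)"
    using exp_ge_add_one_self[of 1] by (intro mult_right_mono power_mono) auto
  also have "\<dots> = exp (real (n + 1) + real m * x\<^sup>2)"
    by (simp add: exp_add flip: exp_of_nat_mult)
  also have "\<dots> \<le> exp (9 / 4 * n)"
  proof -
    have "real m * x\<^sup>2 = n / 4" using m by (simp add: x_def power_divide)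
    thus ?thesis using m by simp
  qed
  finally have "average (nsets U m) (\<lambda>S. s * cut_discrepancy V S) \<le> 9 / 4 * n"
    by (rule average_exp_jensen[OF fin ne])
  hence *: "s * average (nsets U m) (cut_discrepancy V) \<le> 9 / 4 * n"
    by (simp add: average_cmult)
  have "0 \<le> average (nsets U m) (cut_discrepancy V)"
    unfolding average_def using cut_discrepancy_nonneg[OF assms(1)]
    by (intro divide_nonneg_nonneg sum_nonneg) auto
  hence "x / 2 * average (nsets U m) (cut_discrepancy V) \<le> 9 / 4 * n"
    using * s mult_right_mono by (meson order_trans)
  moreover have "9 / 4 * real n = x / 2 * (9 * sqrt (real n * real m))"
  proof -
    have "sqrt (real n / real m) * sqrt (real n * real m) = n"
      using m by (simp add: real_sqrt_mult[symmetric])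
    thus ?thesis by (simp add: x_def)
  qed
  ultimately show ?thesis
    using x unfolding U_def n_def by (metis half_gt_zero_iff mult_le_cancel_left_pos)
qed

section \<open>Exchanging an edge for a non-edge\<close>

lemma sum_nsets_Suc:
  assumes "finite U"
  shows "(\<Sum>S\<in>nsets U (Suc m). \<Sum>e\<in>S. g S e) = (\<Sum>H\<in>nsets U m. \<Sum>e\<in>U - H. g (insert e H) e)"
proof -
  have "(\<Sum>S\<in>nsets U (Suc m). \<Sum>e\<in>S. g S e) = (\<Sum>(S, e)\<in>Sigma (nsets U (Suc m)) (\<lambda>S. S). g S e)"
    using assms by (intro sum.Sigma finite_imp_finite_nsets) (auto simp: nsets_def)
  also have "\<dots> = (\<Sum>(H, e)\<in>Sigma (nsets U m) (\<lambda>H. U - H). g (insert e H) e)"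
    by (rule sum.reindex_bij_witness[where i = "\<lambda>(H, e). (insert e H, e)" and j = "\<lambda>(S, e). (S - {e}, e)"])
       (auto simp: nsets_def insert_absorb)
  also have "\<dots> = (\<Sum>H\<in>nsets U m. \<Sum>e\<in>U - H. g (insert e H) e)"
    using assms by (intro sum.Sigma[symmetric] finite_imp_finite_nsets) auto
  finally show ?thesis .
qed

text \<open>A uniform \<open>(m + 1)\<close>-set with a uniform element of it has the same distribution as a uniform
\<open>m\<close>-set enlarged by a uniform new element.\<close>

lemma average_nsets_Suc:
  assumes "finite U" "m < card U"
  shows "average (nsets U (Suc m)) (\<lambda>S. \<Sum>e\<in>S. g S e) / real (Suc m) =
    average (nsets U m) (\<lambda>H. \<Sum>e\<in>U - H. g (insert e H) e) / real (card U - m)"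
proof -
  have "Suc m * (card U choose Suc m) = (card U - m) * (card U choose m)"
    by (metis binomial_absorb_comp binomial_absorption mult.commute)
  hence "real (card (nsets U (Suc m))) * real (Suc m) = real (card (nsets U m)) * real (card U - m)"
    by (simp only: card_nsets mult.commute flip: of_nat_mult)
  thus ?thesis unfolding average_def sum_nsets_Suc[OF assms(1)] divide_divide_eq_left by simp
qed

section \<open>Cuts as colourings, and equivalent vertices\<close>

lemma r_cut_of_colouring:
  assumes "\<kappa> \<in> V \<rightarrow> {..<r}" "E \<subseteq> nsets V 2"
  defines "P \<equiv> \<lambda>i. {v \<in> V. \<kappa> v = i}"
  shows "r_cut r (V, E) P" "cut_size r (V, E) P = card (crossing \<kappa> E)"
proof -
  show "r_cut r (V, E) P"
    using assms(1) by (auto simp: r_cut_def P_def disjoint_family_on_def)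
  have "(\<exists>u v i j. e = {u, v} \<and> i < r \<and> j < r \<and> i \<noteq> j \<and> u \<in> P i \<and> v \<in> P j) \<longleftrightarrow>
      (\<exists>u\<in>e. \<exists>v\<in>e. \<kappa> u \<noteq> \<kappa> v)" (is "?L \<longleftrightarrow> ?R") if e: "e \<in> E" for e
  proof
    assume ?L thus ?R unfolding P_def by blast
  next
    assume ?R
    then obtain u v where uv: "u \<in> e" "v \<in> e" "\<kappa> u \<noteq> \<kappa> v" by blast
    have "e \<in> nsets V 2" using e assms by auto
    then obtain a b where ab: "e = {a, b}" "a \<in> V" "b \<in> V" by (elim nsets2_E) auto
    have "\<kappa> a \<noteq> \<kappa> b" using uv unfolding ab by fastforce
    moreover have "\<kappa> a < r" "\<kappa> b < r" using ab assms(1) by auto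
    ultimately show ?L unfolding P_def using ab by blast
  qed
  thus "cut_size r (V, E) P = card (crossing \<kappa> E)"
    unfolding cut_size_def crossing_def snd_conv
    by (intro arg_cong[of _ _ card] Collect_cong conj_cong refl)
qed

lemma colouring_of_r_cut:
  assumes "r_cut r (V, E) P" "E \<subseteq> nsets V 2"
  obtains \<kappa> where "\<kappa> \<in> V \<rightarrow> {..<r}" "cut_size r (V, E) P = card (crossing \<kappa> E)"
    "\<And>u v. u \<in> V \<Longrightarrow> v \<in> V \<Longrightarrow> (\<exists>i<r. u \<in> P i \<and> v \<in> P i) \<longleftrightarrow> \<kappa> u = \<kappa> v"
proof -
  have disj: "disjoint_family_on P {..<r}" and cover: "(\<Union>i<r. P i) = V"
    using assms by (auto simp: r_cut_def)
  have "\<forall>v\<in>V. \<exists>i<r. v \<in> P i" using cover by auto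
  then obtain \<kappa> where \<kappa>: "\<And>v. v \<in> V \<Longrightarrow> \<kappa> v < r" "\<And>v. v \<in> V \<Longrightarrow> v \<in> P (\<kappa> v)"
    by metis
  have uniq: "i = \<kappa> v" if "i < r" "v \<in> P i" for i v
  proof -
    have "v \<in> V" using that cover by auto
    thus ?thesis using disj that \<kappa>[of v] by (auto simp: disjoint_family_on_def)
  qed
  have part: "{v \<in> V. \<kappa> v = i} = P i" if "i < r" for i
    using uniq \<kappa> cover that by auto
  have mem: "\<kappa> \<in> V \<rightarrow> {..<r}" using \<kappa> by auto
  have "cut_size r (V, E) P = cut_size r (V, E) (\<lambda>i. {v \<in> V. \<kappa> v = i})"
    unfolding cut_size_def by (simp only: part cong: conj_cong)
  hence size: "cut_size r (V, E) P = card (crossing \<kappa> E)"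
    using r_cut_of_colouring(2)[OF mem assms(2)] by simp
  show thesis
  proof (rule that[OF mem size])
    fix u v assume uv: "u \<in> V" "v \<in> V"
    show "(\<exists>i<r. u \<in> P i \<and> v \<in> P i) \<longleftrightarrow> \<kappa> u = \<kappa> v"
      using uniq[of _ u] uniq[of _ v] \<kappa>[OF uv(1)] \<kappa>[OF uv(2)] by metis
  qed
qed

lemma finite_cut_sizes:
  assumes "finite E" shows "finite {cut_size r (V, E) P | P. r_cut r (V, E) P}"
proof (rule finite_subset)
  show "{cut_size r (V, E) P | P. r_cut r (V, E) P} \<subseteq> {..card E}"
    using assms by (auto simp: cut_size_def intro!: card_mono)
qed simp

lemma card_crossing_le_max_cut:
  assumes "\<kappa> \<in> V \<rightarrow> {..<r}" "E \<subseteq> nsets V 2" "finite E"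
  shows "card (crossing \<kappa> E) \<le> max_cut r (V, E)"
  unfolding max_cut_def using r_cut_of_colouring[OF assms(1,2)] finite_cut_sizes[OF assms(3)]
  by (intro Max_ge) (auto intro: exI[of _ "\<lambda>i. {v \<in> V. \<kappa> v = i}"])

lemma max_cut_attained:
  assumes "E \<subseteq> nsets V 2" "finite E" "r \<ge> 1"
  obtains \<kappa> where "\<kappa> \<in> V \<rightarrow> {..<r}" "card (crossing \<kappa> E) = max_cut r (V, E)"
proof -
  have "(\<lambda>_. 0) \<in> V \<rightarrow> {..<r}" using assms by auto
  from r_cut_of_colouring(1)[OF this assms(1)]
  have "{cut_size r (V, E) P | P. r_cut r (V, E) P} \<noteq> {}" by blast
  hence "max_cut r (V, E) \<in> {cut_size r (V, E) P | P. r_cut r (V, E) P}"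
    unfolding max_cut_def using finite_cut_sizes[OF assms(2)] by (intro Max_in)
  then obtain P where P: "r_cut r (V, E) P" "max_cut r (V, E) = cut_size r (V, E) P" by blast
  from colouring_of_r_cut[OF P(1) assms(1)] show thesis using that P(2) by metis
qed

text \<open>The relation of the definitions, expressed by colourings instead of labelled partitions.\<close>

lemma dr_equiv_iff:
  assumes "E \<subseteq> nsets V 2"
  shows "(u, v) \<in> dr_equiv d r (V, E) \<longleftrightarrow> u \<in> V \<and> v \<in> V \<and>
    (\<forall>\<kappa> \<in> V \<rightarrow> {..<r}. max_cut r (V, E) \<le> card (crossing \<kappa> E) + d \<longrightarrow> \<kappa> u = \<kappa> v)"
proof -
  have "(\<forall>P. r_cut r (V, E) P \<and> deficit r (V, E) P \<le> int d \<longrightarrow> (\<exists>i<r. u \<in> P i \<and> v \<in> P i)) \<longleftrightarrow>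
      (\<forall>\<kappa> \<in> V \<rightarrow> {..<r}. max_cut r (V, E) \<le> card (crossing \<kappa> E) + d \<longrightarrow> \<kappa> u = \<kappa> v)"
    (is "?L \<longleftrightarrow> ?R") if uv: "u \<in> V" "v \<in> V"
  proof
    assume L: ?L
    show ?R
    proof (intro ballI impI)
      fix \<kappa> assume \<kappa>: "\<kappa> \<in> V \<rightarrow> {..<r}" "max_cut r (V, E) \<le> card (crossing \<kappa> E) + d"
      note cut = r_cut_of_colouring[OF \<kappa>(1) assms]
      have "deficit r (V, E) (\<lambda>i. {v \<in> V. \<kappa> v = i}) \<le> int d"
        using \<kappa>(2) unfolding deficit_def cut(2) by linarith
      hence "\<exists>i<r. u \<in> {v \<in> V. \<kappa> v = i} \<and> v \<in> {v \<in> V. \<kappa> v = i}" using L cut(1) by blast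
      thus "\<kappa> u = \<kappa> v" by auto
    qed
  next
    assume R: ?R
    show ?L
    proof (intro allI impI)
      fix P assume P: "r_cut r (V, E) P \<and> deficit r (V, E) P \<le> int d"
      then obtain \<kappa> where \<kappa>: "\<kappa> \<in> V \<rightarrow> {..<r}" "cut_size r (V, E) P = card (crossing \<kappa> E)"
        "(\<exists>i<r. u \<in> P i \<and> v \<in> P i) \<longleftrightarrow> \<kappa> u = \<kappa> v"
        using colouring_of_r_cut[OF _ assms] uv by metis
      have "max_cut r (V, E) \<le> card (crossing \<kappa> E) + d"
        using P unfolding deficit_def \<kappa>(2) by linarith
      thus "\<exists>i<r. u \<in> P i \<and> v \<in> P i" using R \<kappa> by blast
    qed
  qed
  thus ?thesis unfolding dr_equiv_def by auto
qed

lemma equiv_dr_equiv: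
  assumes "E \<subseteq> nsets V 2"
  shows "equiv V (dr_equiv d r (V, E))"
  unfolding equiv_def refl_on_def sym_def trans_def
  by (auto simp: dr_equiv_iff[OF assms])

text \<open>The pairs of vertices separated by some \<open>r\<close>-cut of deficit at most \<open>d\<close>. The definition colours every
vertex by its \<open>(d, r)\<close>-component, so that the discrepancy bound for colourings applies to these pairs.\<close>

definition inequivalent_pairs :: "nat \<Rightarrow> nat \<Rightarrow> 'a set \<Rightarrow> 'a set set \<Rightarrow> 'a set set" where
  "inequivalent_pairs d r V E = crossing (\<lambda>v. dr_equiv d r (V, E) `` {v}) (nsets V 2)"

lemma inequivalent_pairs_iff:
  assumes "E \<subseteq> nsets V 2"
  shows "e \<in> inequivalent_pairs d r V E \<longleftrightarrow> e \<in> nsets V 2 \<and>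
    (\<exists>\<kappa> \<in> V \<rightarrow> {..<r}. max_cut r (V, E) \<le> card (crossing \<kappa> E) + d \<and>
      (\<exists>u\<in>e. \<exists>v\<in>e. \<kappa> u \<noteq> \<kappa> v))"
proof -
  have *: "dr_equiv d r (V, E) `` {u} \<noteq> dr_equiv d r (V, E) `` {v} \<longleftrightarrow>
      (\<exists>\<kappa> \<in> V \<rightarrow> {..<r}. max_cut r (V, E) \<le> card (crossing \<kappa> E) + d \<and> \<kappa> u \<noteq> \<kappa> v)"
    if "e \<in> nsets V 2" "u \<in> e" "v \<in> e" for u v
  proof -
    have "u \<in> V" "v \<in> V" using that by (auto simp: nsets_def)
    thus ?thesis
      using eq_equiv_class_iff[OF equiv_dr_equiv[OF assms], of u v d r] dr_equiv_iff[OF assms, of u v d r]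
      by blast
  qed
  show ?thesis unfolding inequivalent_pairs_def crossing_iff
  proof (intro conj_cong refl)
    assume e: "e \<in> nsets V 2"
    have "(\<exists>u\<in>e. \<exists>v\<in>e. dr_equiv d r (V, E) `` {u} \<noteq> dr_equiv d r (V, E) `` {v}) \<longleftrightarrow>
        (\<exists>u\<in>e. \<exists>v\<in>e. \<exists>\<kappa> \<in> V \<rightarrow> {..<r}. max_cut r (V, E) \<le> card (crossing \<kappa> E) + d \<and> \<kappa> u \<noteq> \<kappa> v)"
      by (rule bex_cong[OF refl], rule bex_cong[OF refl], rule *[OF e])
    thus "(\<exists>u\<in>e. \<exists>v\<in>e. dr_equiv d r (V, E) `` {u} \<noteq> dr_equiv d r (V, E) `` {v}) \<longleftrightarrow>
        (\<exists>\<kappa> \<in> V \<rightarrow> {..<r}. max_cut r (V, E) \<le> card (crossing \<kappa> E) + d \<and>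
          (\<exists>u\<in>e. \<exists>v\<in>e. \<kappa> u \<noteq> \<kappa> v))" by blast
  qed
qed

text \<open>If a cut of deficit at most \<open>d + 1\<close> separates a non-edge \<open>e\<close>, then adding \<open>e\<close> improves this cut by
one, so \<open>e\<close> is separated in the new graph with deficit at most \<open>d\<close> unless the maximum has grown;
but in that case every maximum cut of the new graph contains \<open>e\<close>.\<close>

lemma inequivalent_pairs_insert:
  assumes "insert e E \<subseteq> nsets V 2" "finite E" "e \<notin> E" "r \<ge> 1"
    and "e \<in> inequivalent_pairs (Suc d) r V E"
  shows "e \<in> inequivalent_pairs d r V (insert e E)"
proof -
  have sub: "E \<subseteq> nsets V 2" using assms by auto
  obtain \<kappa> where \<kappa>: "\<kappa> \<in> V \<rightarrow> {..<r}" "max_cut r (V, E) \<le> card (crossing \<kappa> E) + Suc d"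
    "\<exists>u\<in>e. \<exists>v\<in>e. \<kappa> u \<noteq> \<kappa> v"
    using assms(5) unfolding inequivalent_pairs_iff[OF sub] by blast
  obtain \<kappa>' where \<kappa>': "\<kappa>' \<in> V \<rightarrow> {..<r}" "card (crossing \<kappa>' (insert e E)) = max_cut r (V, insert e E)"
    using max_cut_attained[of "insert e E" V r] assms by auto
  have eV: "e \<in> nsets V 2" using assms by auto
  have k: "card (crossing \<kappa> (insert e E)) = card (crossing \<kappa> E) + 1"
    by (rule card_crossing_insert(1)[OF assms(2,3) \<kappa>(3)])
  show ?thesis
  proof (cases "max_cut r (V, insert e E) \<le> max_cut r (V, E)")
    case True
    hence "max_cut r (V, insert e E) \<le> card (crossing \<kappa> (insert e E)) + d"
      using \<kappa>(2) k by linarith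
    thus ?thesis unfolding inequivalent_pairs_iff[OF assms(1)] using \<kappa>(1,3) eV by blast
  next
    case False
    moreover have "card (crossing \<kappa>' E) \<le> max_cut r (V, E)"
      by (rule card_crossing_le_max_cut[OF \<kappa>'(1) sub assms(2)])
    ultimately have "card (crossing \<kappa>' (insert e E)) \<noteq> card (crossing \<kappa>' E)"
      using \<kappa>'(2) by linarith
    hence "\<exists>u\<in>e. \<exists>v\<in>e. \<kappa>' u \<noteq> \<kappa>' v"
      using card_crossing_insert(2)[OF assms(2,3), of \<kappa>'] by blast
    moreover have "max_cut r (V, insert e E) \<le> card (crossing \<kappa>' (insert e E)) + d"
      using \<kappa>'(2) by linarith
    ultimately show ?thesis unfolding inequivalent_pairs_iff[OF assms(1)] using \<kappa>'(1) eV by blast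
  qed
qed

text \<open>Adding a non-edge that some maximum cut separates increases the maximum, so that afterwards
every maximum cut contains this edge.\<close>

lemma inequivalent_pairs_crossing:
  assumes "insert e E \<subseteq> nsets V 2" "finite E" "e \<notin> E"
    and "e \<in> inequivalent_pairs 0 r V E"
    and "\<kappa>' \<in> V \<rightarrow> {..<r}" "card (crossing \<kappa>' (insert e E)) = max_cut r (V, insert e E)"
  shows "e \<in> crossing \<kappa>' (insert e E)"
proof -
  have sub: "E \<subseteq> nsets V 2" using assms by auto
  obtain \<kappa> where \<kappa>: "\<kappa> \<in> V \<rightarrow> {..<r}" "max_cut r (V, E) \<le> card (crossing \<kappa> E)"
    "\<exists>u\<in>e. \<exists>v\<in>e. \<kappa> u \<noteq> \<kappa> v"
    using assms(4) unfolding inequivalent_pairs_iff[OF sub] by auto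
  have k: "card (crossing \<kappa> (insert e E)) = card (crossing \<kappa> E) + 1"
    by (rule card_crossing_insert(1)[OF assms(2,3) \<kappa>(3)])
  have "card (crossing \<kappa> (insert e E)) \<le> max_cut r (V, insert e E)"
    using assms by (intro card_crossing_le_max_cut \<kappa>(1)) auto
  moreover have "card (crossing \<kappa>' E) \<le> max_cut r (V, E)"
    by (rule card_crossing_le_max_cut[OF assms(5) sub assms(2)])
  ultimately have "card (crossing \<kappa>' (insert e E)) \<noteq> card (crossing \<kappa>' E)"
    using \<kappa>(2) k assms(6) by linarith
  hence "\<exists>u\<in>e. \<exists>v\<in>e. \<kappa>' u \<noteq> \<kappa>' v"
    using card_crossing_insert(2)[OF assms(2,3), of \<kappa>'] by blast
  thus ?thesis unfolding crossing_def by blast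
qed

section \<open>Pairs of vertices of the same colour\<close>

lemma card_nsets_2:
  "2 * real (card (nsets V 2)) = real (card V) * (real (card V) - 1)"
proof (cases "card V")
  case (Suc k)
  have "2 * (card V choose 2) = card V * (card V - 1)"
    using binomial_absorption[of 1 "card V"] by (simp add: numeral_2_eq_2)
  hence "2 * real (card (nsets V 2)) = real (card V * (card V - 1))" by (simp flip: of_nat_mult)
  thus ?thesis using Suc by (simp add: algebra_simps)
qed simp

text \<open>Ordered pairs of vertices are either of the same colour or one of the two orientations of a
crossing pair.\<close>

lemma sum_card_same_colour:
  assumes "finite V"
  shows "(\<Sum>u\<in>V. card {v \<in> V. \<kappa> v = \<kappa> u}) + 2 * card (crossing \<kappa> (nsets V 2)) = (card V)\<^sup>2"
proof -
  define T where "T = crossing \<kappa> (nsets V 2)"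
  define S where "S = Sigma V (\<lambda>u. {v \<in> V. \<kappa> v \<noteq> \<kappa> u})"
  have finS: "finite S" using assms by (auto simp: S_def)
  have finT: "finite T"
    using assms finite_imp_finite_nsets crossing_subset unfolding T_def by (metis finite_subset)
  have im: "(\<lambda>(u, v). {u, v}) ` S \<subseteq> T"
    by (auto simp: S_def T_def crossing_iff)
  have two: "card {p \<in> S. (\<lambda>(u, v). {u, v}) p = e} = 2" if "e \<in> T" for e
  proof -
    have e: "e \<in> nsets V 2" "\<exists>u\<in>e. \<exists>v\<in>e. \<kappa> u \<noteq> \<kappa> v"
      using that unfolding T_def crossing_iff by blast+
    from e(1) obtain a b where ab: "a \<in> V" "b \<in> V" "a \<noteq> b" "e = {a, b}"
      by (rule nsets2_E) blast
    have "\<kappa> a \<noteq> \<kappa> b"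
    proof
      assume "\<kappa> a = \<kappa> b"
      thus False using e(2) by (auto simp: ab(4))
    qed
    hence "{p \<in> S. (\<lambda>(u, v). {u, v}) p = e} = {(a, b), (b, a)}"
      using ab by (auto simp: S_def doubleton_eq_iff)
    thus ?thesis using ab by simp
  qed
  have "card S = (\<Sum>e\<in>T. \<Sum>p\<in>{p \<in> S. (\<lambda>(u, v). {u, v}) p = e}. 1)"
    using sum.group[OF finS finT im, of "\<lambda>_. 1 :: nat"] by simp
  also have "\<dots> = 2 * card T" using two by simp
  finally have S: "card S = 2 * card T" .
  have "(card V)\<^sup>2 = (\<Sum>u\<in>V. card {v \<in> V. \<kappa> v = \<kappa> u} + card {v \<in> V. \<kappa> v \<noteq> \<kappa> u})"
  proof -
    have "card {v \<in> V. \<kappa> v = \<kappa> u} + card {v \<in> V. \<kappa> v \<noteq> \<kappa> u} = card V" for u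
    proof -
      have "card ({v \<in> V. \<kappa> v = \<kappa> u} \<union> {v \<in> V. \<kappa> v \<noteq> \<kappa> u}) =
          card {v \<in> V. \<kappa> v = \<kappa> u} + card {v \<in> V. \<kappa> v \<noteq> \<kappa> u}"
        using assms by (intro card_Un_disjoint) auto
      moreover have "{v \<in> V. \<kappa> v = \<kappa> u} \<union> {v \<in> V. \<kappa> v \<noteq> \<kappa> u} = V" by auto
      ultimately show ?thesis by simp
    qed
    thus ?thesis by (simp add: power2_eq_square)
  qed
  also have "\<dots> = (\<Sum>u\<in>V. card {v \<in> V. \<kappa> v = \<kappa> u}) + card S"
    using assms by (simp add: S_def sum.distrib card_SigmaI)
  finally show ?thesis using S by (simp add: T_def)
qed

lemma sum_over_colours:
  fixes h :: "nat \<Rightarrow> 'b :: comm_semiring_1"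
  assumes "finite V" "\<kappa> \<in> V \<rightarrow> {..<r}"
  shows "(\<Sum>u\<in>V. h (\<kappa> u)) = (\<Sum>i<r. of_nat (card {v \<in> V. \<kappa> v = i}) * h i)"
proof -
  have "(\<Sum>u\<in>V. h (\<kappa> u)) = (\<Sum>i<r. \<Sum>u\<in>{u \<in> V. \<kappa> u = i}. h (\<kappa> u))"
    using assms by (intro sum.group[symmetric]) auto
  also have "\<dots> = (\<Sum>i<r. \<Sum>u\<in>{u \<in> V. \<kappa> u = i}. h i)"
    by (intro sum.cong refl) auto
  finally show ?thesis by simp
qed

text \<open>The number of ordered pairs of the same colour exceeds its minimum \<open>n\<^sup>2/r\<close> by exactly the sum of the
squared deviations of the colour classes from \<open>n/r\<close>. Hence few such pairs force a balanced
colouring.\<close>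

lemma sum_colour_class_deviations:
  assumes "finite V" "\<kappa> \<in> V \<rightarrow> {..<r}" "r \<ge> 1"
  shows "(\<Sum>i<r. (real (card {v \<in> V. \<kappa> v = i}) - real (card V) / real r)\<^sup>2) =
    real (\<Sum>u\<in>V. card {v \<in> V. \<kappa> v = \<kappa> u}) - (real (card V))\<^sup>2 / real r"
proof -
  define c where "c = (\<lambda>i. real (card {v \<in> V. \<kappa> v = i}))"
  define n where "n = real (card V)"
  have 1: "(\<Sum>i<r. c i) = n"
    using sum_over_colours[OF assms(1,2), of "\<lambda>_. 1 :: real"] by (simp add: c_def n_def)
  have 2: "real (\<Sum>u\<in>V. card {v \<in> V. \<kappa> v = \<kappa> u}) = (\<Sum>i<r. (c i)\<^sup>2)"
    using sum_over_colours[OF assms(1,2), of c] by (simp add: c_def power2_eq_square)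
  have "(\<Sum>i<r. (c i - n / r)\<^sup>2) = (\<Sum>i<r. (c i)\<^sup>2 - 2 * (n / r) * c i + (n / r)\<^sup>2)"
    by (intro sum.cong refl) (simp add: power2_diff)
  also have "\<dots> = (\<Sum>i<r. (c i)\<^sup>2) - 2 * (n / r) * (\<Sum>i<r. c i) + r * (n / r)\<^sup>2"
    by (simp only: sum.distrib sum_subtractf sum_distrib_left[symmetric] sum_constant card_lessThan)
  also have "\<dots> = (\<Sum>i<r. (c i)\<^sup>2) - n\<^sup>2 / r"
    unfolding 1 using assms(3) by (simp add: field_simps power2_eq_square)
  finally show ?thesis unfolding 2 by (simp add: c_def n_def)
qed

lemma card_crossing_le:
  assumes "finite V" "\<kappa> \<in> V \<rightarrow> {..<r}" "r \<ge> 1"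
  shows "2 * real (card (crossing \<kappa> (nsets V 2))) \<le> (1 - 1 / real r) * (real (card V))\<^sup>2"
proof -
  have "0 \<le> (\<Sum>i<r. (real (card {v \<in> V. \<kappa> v = i}) - real (card V) / real r)\<^sup>2)"
    by (intro sum_nonneg) auto
  moreover have "real (\<Sum>u\<in>V. card {v \<in> V. \<kappa> v = \<kappa> u}) + 2 * real (card (crossing \<kappa> (nsets V 2))) = (real (card V))\<^sup>2"
    using arg_cong[OF sum_card_same_colour[OF assms(1), of \<kappa>], of real] by simp
  ultimately show ?thesis
    unfolding sum_colour_class_deviations[OF assms] by (simp add: algebra_simps)
qed

section \<open>The expected proportion of inequivalent pairs\<close>

text \<open>The expected discrepancy of a random graph with \<open>m\<close> edges on \<open>V\<close>.\<close>

definition mean_discrepancy :: "'a set \<Rightarrow> nat \<Rightarrow> real" where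
  "mean_discrepancy V m = average (nsets (nsets V 2) m) (cut_discrepancy V)"

text \<open>The expected proportion of \<open>(d, r)\<close>-inequivalent pairs in a random graph with \<open>m\<close> edges on \<open>V\<close>.\<close>

definition mean_inequivalent :: "nat \<Rightarrow> nat \<Rightarrow> 'a set \<Rightarrow> nat \<Rightarrow> real" where
  "mean_inequivalent d r V m =
     average (nsets (nsets V 2) m) (\<lambda>E. real (card (inequivalent_pairs d r V E))) / real (card (nsets V 2))"

lemma card_crossing_approx:
  assumes "finite V" "E \<in> nsets (nsets V 2) m"
  shows "\<bar>real (card (crossing \<kappa> E)) - real m / real (card (nsets V 2)) * real (card (crossing \<kappa> (nsets V 2)))\<bar>
    \<le> 2 * cut_discrepancy V E"
  using colouring_discrepancy[OF assms(1), of E \<kappa>] assms(2) by (simp add: nsets_def)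

text \<open>By the discrepancy bound, the proportion of inequivalent pairs is nearly the same among all
pairs as among the non-edges.\<close>

lemma mean_inequivalent_le_nonedges:
  assumes "finite V" "m < card (nsets V 2)"
  defines "U \<equiv> nsets V 2"
  shows "mean_inequivalent d r V m \<le>
    average (nsets U m) (\<lambda>H. \<Sum>e\<in>U - H. of_bool (e \<in> inequivalent_pairs d r V H)) / real (card U - m)
    + 2 * mean_discrepancy V m / real (card U - m)"
proof -
  define N where "N = real (card U)"
  have Nm: "real (card U - m) = N - m" "N - m > 0" "N > 0"
    using assms(2) unfolding N_def U_def by (simp_all add: of_nat_diff del: card_nsets)
  have finU: "finite U" using assms finite_imp_finite_nsets by blast
  have "average (nsets U m) (\<lambda>H. (N - m) / N * real (card (inequivalent_pairs d r V H))) \<le>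
    average (nsets U m) (\<lambda>H. (\<Sum>e\<in>U - H. of_bool (e \<in> inequivalent_pairs d r V H)) + 2 * cut_discrepancy V H)"
  proof (rule average_mono)
    fix H assume H: "H \<in> nsets U m"
    hence HU: "H \<subseteq> U" by (auto simp: nsets_def)
    let ?I = "inequivalent_pairs d r V H"
    let ?\<kappa> = "\<lambda>v. dr_equiv d r (V, H) `` {v}"
    have I: "?I = crossing ?\<kappa> U" by (simp add: inequivalent_pairs_def U_def)
    hence IU: "?I \<subseteq> U" using crossing_subset by metis
    have "real (card (crossing ?\<kappa> H)) \<le> real m / N * real (card ?I) + 2 * cut_discrepancy V H"
      using card_crossing_approx[OF assms(1), of H m ?\<kappa>] H unfolding I N_def U_def by linarith
    moreover have "card (crossing ?\<kappa> H) = card (H \<inter> ?I)"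
      unfolding I by (rule arg_cong[OF crossing_Int[OF HU]])
    moreover have "real (card ?I) = real (card (H \<inter> ?I)) + real (card ((U - H) \<inter> ?I))"
    proof -
      have "card ((H \<inter> ?I) \<union> ((U - H) \<inter> ?I)) = card (H \<inter> ?I) + card ((U - H) \<inter> ?I)"
        using finU HU finite_subset by (intro card_Un_disjoint) auto
      moreover have "(H \<inter> ?I) \<union> ((U - H) \<inter> ?I) = ?I" using IU HU by auto
      ultimately show ?thesis by simp
    qed
    moreover have "(\<Sum>e\<in>U - H. of_bool (e \<in> ?I)) = real (card ((U - H) \<inter> ?I))"
      using finU by (simp add: sum_of_bool_eq)
    moreover have "(N - m) / N * real (card ?I) = real (card ?I) - real m / N * real (card ?I)"
      using Nm by (simp add: diff_divide_distrib left_diff_distrib)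
    ultimately show "(N - m) / N * real (card ?I) \<le> (\<Sum>e\<in>U - H. of_bool (e \<in> ?I)) + 2 * cut_discrepancy V H"
      by linarith
  qed
  hence "(N - m) * mean_inequivalent d r V m \<le>
      average (nsets U m) (\<lambda>H. \<Sum>e\<in>U - H. of_bool (e \<in> inequivalent_pairs d r V H)) + 2 * mean_discrepancy V m"
    unfolding average_cmult average_add
    by (simp add: mean_inequivalent_def mean_discrepancy_def N_def U_def)
  thus ?thesis unfolding Nm(1) using Nm by (simp add: field_simps flip: add_divide_distrib)
qed

text \<open>Exchanging a random non-edge of the graph with \<open>m\<close> edges for a random edge of the graph with
\<open>m + 1\<close> edges lowers the deficit by one, at the price of two discrepancy terms.\<close>

lemma mean_inequivalent_Suc_le:
  assumes "finite V" "m < card (nsets V 2)" "r \<ge> 1"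
  shows "mean_inequivalent (Suc d) r V m \<le> mean_inequivalent d r V (Suc m)
    + 2 * mean_discrepancy V (Suc m) / real (Suc m)
    + 2 * mean_discrepancy V m / real (card (nsets V 2) - m)"
proof -
  define U where "U = nsets V 2"
  have finU: "finite U" using assms finite_imp_finite_nsets unfolding U_def by blast
  have "average (nsets U m) (\<lambda>H. \<Sum>e\<in>U - H. of_bool (e \<in> inequivalent_pairs (Suc d) r V H))
      \<le> average (nsets U m) (\<lambda>H. \<Sum>e\<in>U - H. of_bool (e \<in> inequivalent_pairs d r V (insert e H)))"
  proof (intro average_mono sum_mono)
    fix H e assume "H \<in> nsets U m" "e \<in> U - H"
    hence "insert e H \<subseteq> nsets V 2" "finite H" "e \<notin> H" by (auto simp: nsets_def U_def)
    thus "of_bool (e \<in> inequivalent_pairs (Suc d) r V H) \<le> (of_bool (e \<in> inequivalent_pairs d r V (insert e H)) :: real)"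
      using inequivalent_pairs_insert[of e H V r d] assms(3) by auto
  qed
  hence "average (nsets U m) (\<lambda>H. \<Sum>e\<in>U - H. of_bool (e \<in> inequivalent_pairs (Suc d) r V H)) / real (card U - m)
      \<le> average (nsets U (Suc m)) (\<lambda>S. \<Sum>e\<in>S. of_bool (e \<in> inequivalent_pairs d r V S)) / real (Suc m)"
    using average_nsets_Suc[OF finU, of m "\<lambda>S e. of_bool (e \<in> inequivalent_pairs d r V S)"] assms(2)
    by (simp add: divide_right_mono U_def)
  also have "\<dots> \<le> average (nsets U (Suc m)) (\<lambda>S. real (Suc m) / real (card U) * real (card (inequivalent_pairs d r V S))
      + 2 * cut_discrepancy V S) / real (Suc m)"
  proof (intro divide_right_mono average_mono)
    fix S assume S: "S \<in> nsets U (Suc m)"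
    let ?\<kappa> = "\<lambda>v. dr_equiv d r (V, S) `` {v}"
    have I: "inequivalent_pairs d r V S = crossing ?\<kappa> U" by (simp add: inequivalent_pairs_def U_def)
    have SU: "S \<subseteq> U" "finite S" using S by (auto simp: nsets_def)
    have "(\<Sum>e\<in>S. of_bool (e \<in> inequivalent_pairs d r V S)) = real (card (crossing ?\<kappa> S))"
      using SU crossing_Int[OF SU(1), of ?\<kappa>] by (simp add: sum_of_bool_eq I)
    thus "(\<Sum>e\<in>S. of_bool (e \<in> inequivalent_pairs d r V S)) \<le>
        real (Suc m) / real (card U) * real (card (inequivalent_pairs d r V S)) + 2 * cut_discrepancy V S"
      using card_crossing_approx[OF assms(1), of S "Suc m" ?\<kappa>] S unfolding I U_def by linarith
  qed simp
  also have "\<dots> = mean_inequivalent d r V (Suc m) + 2 * mean_discrepancy V (Suc m) / real (Suc m)"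
    unfolding average_cmult average_add mean_inequivalent_def mean_discrepancy_def U_def[symmetric]
    by (simp add: add_divide_distrib del: of_nat_Suc)
  finally show ?thesis
    unfolding U_def by (rule order_trans[OF mean_inequivalent_le_nonedges[OF assms(1,2)] add_right_mono])
qed

text \<open>The same exchange for maximum cuts: non-edges separated by a maximum cut become edges of
one fixed maximum cut \<open>K S\<close> of the larger graph \<open>S\<close>, and \<open>r\<close> parts separate at most \<open>(1 - 1/r) n\<^sup>2/2\<close>
pairs.\<close>

lemma mean_inequivalent_0_le:
  assumes "finite V" "m < card (nsets V 2)" "r \<ge> 1"
  shows "mean_inequivalent 0 r V m \<le> (1 - 1 / real r) * (real (card V))\<^sup>2 / (2 * real (card (nsets V 2)))
    + 2 * mean_discrepancy V (Suc m) / real (Suc m)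
    + 2 * mean_discrepancy V m / real (card (nsets V 2) - m)"
proof -
  define U where "U = nsets V 2"
  define c where "c = (1 - 1 / real r) * (real (card V))\<^sup>2 / 2"
  have finU: "finite U" using assms finite_imp_finite_nsets unfolding U_def by blast
  have "\<exists>\<kappa>. \<kappa> \<in> V \<rightarrow> {..<r} \<and> card (crossing \<kappa> S) = max_cut r (V, S)" if "S \<in> nsets U k" for S k
  proof -
    have "S \<subseteq> nsets V 2" "finite S" using that by (auto simp: nsets_def U_def)
    from max_cut_attained[OF this assms(3)] show ?thesis by metis
  qed
  then obtain K where K: "\<And>S k. S \<in> nsets U k \<Longrightarrow> K S \<in> V \<rightarrow> {..<r}"
    "\<And>S k. S \<in> nsets U k \<Longrightarrow> card (crossing (K S) S) = max_cut r (V, S)"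
    by metis
  have "average (nsets U m) (\<lambda>H. \<Sum>e\<in>U - H. of_bool (e \<in> inequivalent_pairs 0 r V H))
      \<le> average (nsets U m) (\<lambda>H. \<Sum>e\<in>U - H. of_bool (e \<in> crossing (K (insert e H)) (insert e H)))"
  proof (intro average_mono sum_mono)
    fix H e assume "H \<in> nsets U m" "e \<in> U - H"
    hence *: "insert e H \<subseteq> nsets V 2" "finite H" "e \<notin> H" "insert e H \<in> nsets U (Suc m)"
      by (auto simp: nsets_def U_def)
    show "of_bool (e \<in> inequivalent_pairs 0 r V H) \<le> (of_bool (e \<in> crossing (K (insert e H)) (insert e H)) :: real)"
      using inequivalent_pairs_crossing[OF *(1-3) _ K(1)[OF *(4)] K(2)[OF *(4)]] by auto
  qed
  hence "average (nsets U m) (\<lambda>H. \<Sum>e\<in>U - H. of_bool (e \<in> inequivalent_pairs 0 r V H)) / real (card U - m)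
      \<le> average (nsets U (Suc m)) (\<lambda>S. \<Sum>e\<in>S. of_bool (e \<in> crossing (K S) S)) / real (Suc m)"
    using average_nsets_Suc[OF finU, of m "\<lambda>S e. of_bool (e \<in> crossing (K S) S)"] assms(2)
    by (simp add: divide_right_mono U_def)
  also have "\<dots> \<le> average (nsets U (Suc m)) (\<lambda>S. real (Suc m) / real (card U) * c
      + 2 * cut_discrepancy V S) / real (Suc m)"
  proof (intro divide_right_mono average_mono)
    fix S assume S: "S \<in> nsets U (Suc m)"
    have SU: "S \<subseteq> U" "finite S" using S by (auto simp: nsets_def)
    have "real (card (crossing (K S) U)) \<le> c"
      using card_crossing_le[OF assms(1) K(1)[OF S] assms(3)] by (simp add: c_def U_def)
    hence "real (Suc m) / real (card U) * real (card (crossing (K S) U)) \<le> real (Suc m) / real (card U) * c"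
      by (intro mult_left_mono) auto
    moreover have "(\<Sum>e\<in>S. of_bool (e \<in> crossing (K S) S)) = real (card (crossing (K S) S))"
      using SU crossing_subset[of "K S" S] by (simp add: sum_of_bool_eq Int_absorb1)
    ultimately show "(\<Sum>e\<in>S. of_bool (e \<in> crossing (K S) S)) \<le>
        real (Suc m) / real (card U) * c + 2 * cut_discrepancy V S"
      using card_crossing_approx[OF assms(1), of S "Suc m" "K S"] S unfolding U_def by linarith
  qed simp
  also have "\<dots> = c / real (card U) + 2 * mean_discrepancy V (Suc m) / real (Suc m)"
  proof -
    have "nsets U (Suc m) \<noteq> {}" "finite (nsets U (Suc m))"
      using assms(2) finU finite_imp_finite_nsets by (auto simp: nsets_eq_empty_iff U_def)
    thus ?thesis
      unfolding average_add average_cmult mean_discrepancy_def U_def[symmetric]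
      by (simp add: average_const add_divide_distrib del: of_nat_Suc)
  qed
  finally have "average (nsets U m) (\<lambda>H. \<Sum>e\<in>U - H. of_bool (e \<in> inequivalent_pairs 0 r V H)) / real (card U - m)
      \<le> (1 - 1 / real r) * (real (card V))\<^sup>2 / (2 * real (card U)) + 2 * mean_discrepancy V (Suc m) / real (Suc m)"
    by (simp only: c_def divide_divide_eq_left)
  thus ?thesis
    unfolding U_def by (rule order_trans[OF mean_inequivalent_le_nonedges[OF assms(1,2)] add_right_mono])
qed

text \<open>Iterating the exchange step \<open>d\<close> times, along graphs with \<open>m, \<dots>, m + d + 1\<close> edges.\<close>

lemma mean_inequivalent_le:
  assumes "finite V" "r \<ge> 1"
    and "\<And>k. m \<le> k \<Longrightarrow> k \<le> m + d \<Longrightarrow> k < card (nsets V 2)"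
    and "\<And>k. m \<le> k \<Longrightarrow> k \<le> m + d \<Longrightarrow> 2 * mean_discrepancy V (Suc k) / real (Suc k)
      + 2 * mean_discrepancy V k / real (card (nsets V 2) - k) \<le> \<eta>"
  shows "mean_inequivalent d r V m \<le>
    (1 - 1 / real r) * (real (card V))\<^sup>2 / (2 * real (card (nsets V 2))) + (real d + 1) * \<eta>"
  using assms(3,4)
proof (induction d arbitrary: m)
  case 0
  thus ?case
    using mean_inequivalent_0_le[OF assms(1) 0(1) assms(2), of m] 0(2)[of m] by simp
next
  case (Suc d)
  let ?B = "(1 - 1 / real r) * (real (card V))\<^sup>2 / (2 * real (card (nsets V 2)))"
  have IH: "mean_inequivalent d r V (Suc m) \<le> ?B + (real d + 1) * \<eta>"
    by (rule Suc.IH) (use Suc.prems in auto)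
  have "mean_inequivalent (Suc d) r V m \<le> mean_inequivalent d r V (Suc m) +
      (2 * mean_discrepancy V (Suc m) / real (Suc m) + 2 * mean_discrepancy V m / real (card (nsets V 2) - m))"
    using mean_inequivalent_Suc_le[OF assms(1) Suc.prems(1) assms(2), of m d] by (simp only: add.assoc)
  also have "\<dots> \<le> mean_inequivalent d r V (Suc m) + \<eta>"
    using Suc.prems(2)[of m] by (intro add_left_mono) simp
  also have "\<dots> \<le> ?B + (real d + 1) * \<eta> + \<eta>" using IH by (rule add_right_mono)
  finally have "mean_inequivalent (Suc d) r V m \<le> ?B + (real d + 1) * \<eta> + \<eta>" .
  thus ?case by (simp add: algebra_simps)
qed

section \<open>Existence of the core\<close>

text \<open>Summing the size of the component of each vertex counts the ordered pairs of equivalent vertices.\<close>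

lemma sum_card_dr_class:
  assumes "finite V" "E \<subseteq> nsets V 2"
  shows "real (\<Sum>u\<in>V. card (dr_equiv d r (V, E) `` {u})) =
    (real (card V))\<^sup>2 - 2 * real (card (inequivalent_pairs d r V E))"
proof -
  let ?R = "dr_equiv d r (V, E)"
  note eq = equiv_dr_equiv[OF assms(2), of d r]
  have "{v \<in> V. ?R `` {v} = ?R `` {u}} = ?R `` {u}" if "u \<in> V" for u
    using equiv_class_eq_iff[OF eq, of u] that by auto
  hence "(\<Sum>u\<in>V. card (?R `` {u})) + 2 * card (inequivalent_pairs d r V E) = (card V)\<^sup>2"
    using sum_card_same_colour[OF assms(1), of "\<lambda>v. ?R `` {v}"] by (simp add: inequivalent_pairs_def)
  thus ?thesis using arg_cong[of _ _ real] by fastforce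
qed

lemma class_subset_colour_class:
  assumes "E \<subseteq> nsets V 2" "\<kappa> \<in> V \<rightarrow> {..<r}" "card (crossing \<kappa> E) = max_cut r (V, E)"
  shows "dr_equiv d r (V, E) `` {u} \<subseteq> {v \<in> V. \<kappa> v = \<kappa> u}"
  using dr_equiv_iff[OF assms(1), of u _ d r] assms(2,3) by force

text \<open>One component of size at least \<open>s > n/(r + 1)\<close> inside every part of a maximum cut makes a core: the
vertices outside these \<open>r\<close> components are too few for any other component to be as large.\<close>

lemma is_dr_core_of_large_classes:
  fixes V :: "'a set"
  assumes fin: "finite V" and E: "E \<subseteq> nsets V 2" and V: "V \<noteq> {}" and r: "r \<ge> 1"
    and \<kappa>: "\<kappa> \<in> V \<rightarrow> {..<r}" "card (crossing \<kappa> E) = max_cut r (V, E)"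
    and large: "\<And>i. i < r \<Longrightarrow> \<exists>u\<in>V. \<kappa> u = i \<and> s \<le> real (card (dr_equiv d r (V, E) `` {u}))"
    and s: "real (card V) / (real r + 1) < s"
  shows "\<exists>\<K>. is_dr_core d r (V, E) \<K> \<and> (\<forall>A\<in>\<K>. s \<le> real (card A))"
proof -
  define R where "R = dr_equiv d r (V, E)"
  have eq: "equiv V R" unfolding R_def by (rule equiv_dr_equiv[OF E])
  obtain w where w: "\<And>i. i < r \<Longrightarrow> w i \<in> V" "\<And>i. i < r \<Longrightarrow> \<kappa> (w i) = i"
    "\<And>i. i < r \<Longrightarrow> s \<le> real (card (R `` {w i}))"
    using large unfolding R_def by metis
  define \<K> where "\<K> = (\<lambda>i. R `` {w i}) ` {..<r}"
  have inj: "inj_on (\<lambda>i. R `` {w i}) {..<r}"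
  proof (rule inj_onI)
    fix i j assume ij: "i \<in> {..<r}" "j \<in> {..<r}" "R `` {w i} = R `` {w j}"
    have "w i \<in> R `` {w i}" using w(1) ij equiv_class_self[OF eq] by auto
    hence "w i \<in> {v \<in> V. \<kappa> v = \<kappa> (w j)}"
      using class_subset_colour_class[OF E \<kappa>] ij(3) unfolding R_def by blast
    thus "i = j" using w(2) ij by auto
  qed
  have sub: "\<K> \<subseteq> V // R" using w(1) by (auto simp: \<K>_def intro: quotientI)
  have fK: "finite \<K>" by (simp add: \<K>_def)
  have card: "card \<K> = r" unfolding \<K>_def using card_image[OF inj] by simp
  have ge: "s \<le> real (card A)" if "A \<in> \<K>" for A using that w(3) by (auto simp: \<K>_def)
  have Vsub: "A \<subseteq> V" if "A \<in> V // R" for A using that eq in_quotient_imp_subset by metis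
  have sub_insert: "X \<in> V // R" "X \<subseteq> V" if "X \<in> insert B \<K>" "B \<in> V // R - \<K>" for X B
    using that sub Vsub by auto
  have other: "real (card B) \<le> real (card A)" if A: "A \<in> \<K>" and B: "B \<in> V // R - \<K>" for A B
  proof -
    have "real (card B) + real r * s \<le> real (card B) + (\<Sum>A\<in>\<K>. real (card A))"
      using sum_bounded_below[of \<K> s "\<lambda>A. real (card A)"] ge card by simp
    also have "\<dots> = (\<Sum>A\<in>insert B \<K>. real (card A))" using B fK by simp
    also have "\<dots> = real (card (\<Union>(insert B \<K>)))"
    proof -
      have "card (\<Union>(insert B \<K>)) = (\<Sum>A\<in>insert B \<K>. card A)"
      proof (rule card_Union_disjoint)
        show "pairwise disjnt (insert B \<K>)"
          unfolding pairwise_def disjnt_def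
        proof (intro ballI impI)
          fix X Y assume "X \<in> insert B \<K>" "Y \<in> insert B \<K>" "X \<noteq> Y"
          moreover from this have "X \<in> V // R" "Y \<in> V // R" using sub_insert(1) B by auto
          ultimately show "X \<inter> Y = {}" using quotient_disj[OF eq] by blast
        qed
        show "\<And>A. A \<in> insert B \<K> \<Longrightarrow> finite A"
          using finite_subset[OF sub_insert(2)[OF _ B] fin] .
      qed
      thus ?thesis by simp
    qed
    also have "\<dots> \<le> real (card V)"
    proof -
      have "\<Union>(insert B \<K>) \<subseteq> V" using sub_insert(2)[OF _ B] by (rule Union_least)
      thus ?thesis using fin card_mono by (metis of_nat_le_iff)
    qed
    finally have "real (card B) \<le> real (card V) - real r * s" by simp
    moreover have "real (card V) < s * (real r + 1)" using s by (simp add: field_simps)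
    ultimately have "real (card B) < s" by (simp add: algebra_simps)
    thus ?thesis using ge[OF A] by linarith
  qed
  have "is_dr_core d r (V, E) \<K>"
    unfolding is_dr_core_def dr_components_def fst_conv R_def[symmetric]
    using sub card other ge s by (auto intro: less_le_trans)
  thus ?thesis using ge by blast
qed

text \<open>The hypotheses say that the maximum cut \<open>\<kappa>\<close> is nearly balanced and that the number of equivalent
pairs is close to the number of pairs inside the parts of \<open>\<kappa>\<close>. If all components in part \<open>i\<close> were
smaller than \<open>n/r - \<alpha>n\<close>, then each of the at least \<open>n/(2r)\<close> vertices of that part would miss at
least \<open>\<alpha>n/2\<close> vertices of its part, and too many pairs would be lost.\<close>

lemma is_dr_core_of_balanced:
  fixes V :: "'a set" and \<alpha> t :: real
  assumes fin: "finite V" and E: "E \<subseteq> nsets V 2" and V: "V \<noteq> {}" and r: "r \<ge> 1"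
    and \<kappa>: "\<kappa> \<in> V \<rightarrow> {..<r}" "card (crossing \<kappa> E) = max_cut r (V, E)"
    and \<alpha>: "0 < \<alpha>" "\<alpha> < 1 / ((real r)\<^sup>2 + real r)"
    and bal: "real (\<Sum>u\<in>V. card {v \<in> V. \<kappa> v = \<kappa> u}) \<le> (real (card V))\<^sup>2 * (1 / real r + t)"
    and t: "t < (\<alpha> / 2)\<^sup>2"
    and Z: "1 / real r + t - 1 + 2 * real (card (inequivalent_pairs d r V E)) / (real (card V))\<^sup>2 < \<alpha> / (4 * real r)"
  shows "\<exists>\<K>. is_dr_core d r (V, E) \<K> \<and> (\<forall>A\<in>\<K>. real (card V) / real r - \<alpha> * real (card V) \<le> real (card A))"
proof (rule is_dr_core_of_large_classes[OF fin E V r \<kappa>])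
  define n where "n = real (card V)"
  define c where "c = (\<lambda>i. real (card {v \<in> V. \<kappa> v = i}))"
  define s where "s = n / real r - \<alpha> * n"
  let ?cl = "\<lambda>u. real (card (dr_equiv d r (V, E) `` {u}))"
  have n: "n > 0" using fin V by (simp add: n_def card_gt_0_iff)
  have r0: "real r \<ge> 1" using r by simp
  have "1 / ((real r)\<^sup>2 + real r) = 1 / real r - 1 / (real r + 1)"
    using r0 by (simp add: field_simps power2_eq_square)
  hence \<alpha>1: "\<alpha> < 1 / real r - 1 / (real r + 1)" using \<alpha>(2) by simp
  hence "n * \<alpha> < n * (1 / real r - 1 / (real r + 1))" using n by (intro mult_strict_left_mono)
  thus "real (card V) / (real r + 1) < real (card V) / real r - \<alpha> * real (card V)"
    by (simp add: n_def[symmetric] right_diff_distrib mult.commute)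
  have \<alpha>r: "\<alpha> \<le> 1 / real r" using \<alpha>1 r0 by (smt (verit) divide_nonneg_nonneg)
  fix i assume i: "i < r"
  \<comment> \<open>Balance: part \<open>i\<close> has at least \<open>n/r - \<alpha>n/2 \<ge> n/(2r)\<close> vertices.\<close>
  have "(c i - n / r)\<^sup>2 \<le> (\<Sum>i<r. (c i - n / r)\<^sup>2)"
    using i by (intro member_le_sum[where f = "\<lambda>i. (c i - n / r)\<^sup>2"]) auto
  also have "\<dots> \<le> n\<^sup>2 * t"
    using bal sum_colour_class_deviations[OF fin \<kappa>(1) r] by (simp add: c_def n_def algebra_simps)
  also have "\<dots> < n\<^sup>2 * (\<alpha> / 2)\<^sup>2" using t n by (intro mult_strict_left_mono) auto
  finally have "(c i - n / r)\<^sup>2 < (n * (\<alpha> / 2))\<^sup>2" by (simp only: power_mult_distrib)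
  hence "\<bar>c i - n / r\<bar> < n * (\<alpha> / 2)"
    using n \<alpha> by (metis abs_of_pos mult_pos_pos half_gt_zero power2_less_imp_less power2_abs abs_ge_zero less_imp_le)
  hence ci: "c i > n / r - n * \<alpha> / 2" by linarith
  have "n * \<alpha> \<le> n * (1 / real r)" using \<alpha>r n by (intro mult_left_mono) auto
  hence "n * \<alpha> \<le> n / real r" by simp
  moreover have "n / (2 * real r) = n / real r / 2" by simp
  ultimately have ci2: "c i \<ge> n / (2 * real r)" using ci by linarith
  show "\<exists>u\<in>V. \<kappa> u = i \<and> real (card V) / real r - \<alpha> * real (card V) \<le> ?cl u"
  proof (rule ccontr)
    assume "\<not> ?thesis"
    hence small: "?cl u \<le> s" if "u \<in> V" "\<kappa> u = i" for u
      using that unfolding s_def n_def by force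
    have "(\<Sum>u\<in>V. ?cl u) \<le> (\<Sum>u\<in>V. if \<kappa> u = i then s else c (\<kappa> u))"
    proof (rule sum_mono)
      fix u assume u: "u \<in> V"
      have "?cl u \<le> c (\<kappa> u)"
        unfolding c_def using fin class_subset_colour_class[OF E \<kappa>, of d u]
        by (intro of_nat_mono card_mono) auto
      thus "?cl u \<le> (if \<kappa> u = i then s else c (\<kappa> u))" using small[OF u] by auto
    qed
    also have "\<dots> = (\<Sum>j<r. c j * (if j = i then s else c j))"
      unfolding c_def using sum_over_colours[OF fin \<kappa>(1), of "\<lambda>j. if j = i then s else real (card {v \<in> V. \<kappa> v = j})"]
      by simp
    also have "\<dots> = (\<Sum>j<r. c j * c j) - c i * (c i - s)"
      using i by (simp add: sum.remove[of "{..<r}" i] algebra_simps)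
    also have "(\<Sum>j<r. c j * c j) = real (\<Sum>u\<in>V. card {v \<in> V. \<kappa> v = \<kappa> u})"
      unfolding c_def using sum_over_colours[OF fin \<kappa>(1), of "\<lambda>j. real (card {v \<in> V. \<kappa> v = j})"]
      by simp
    also have "\<dots> \<le> n\<^sup>2 * (1 / real r + t)" using bal by (simp add: n_def)
    finally have "(\<Sum>u\<in>V. ?cl u) + c i * (c i - s) \<le> n\<^sup>2 * (1 / real r + t)" by simp
    moreover have "n / (2 * real r) * (n * \<alpha> / 2) \<le> c i * (c i - s)"
      using ci ci2 n \<alpha> by (intro mult_mono) (auto simp: s_def c_def algebra_simps)
    moreover have "(\<Sum>u\<in>V. ?cl u) = n\<^sup>2 - 2 * real (card (inequivalent_pairs d r V E))"
      using sum_card_dr_class[OF fin E, of d r] by (simp add: n_def)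
    ultimately have "n\<^sup>2 - 2 * real (card (inequivalent_pairs d r V E)) + n\<^sup>2 * (\<alpha> / (4 * real r)) \<le> n\<^sup>2 * (1 / real r + t)"
      by (simp add: power2_eq_square mult_ac)
    hence "n\<^sup>2 * (\<alpha> / (4 * real r)) \<le> n\<^sup>2 * (1 / real r + t - 1 + 2 * real (card (inequivalent_pairs d r V E)) / n\<^sup>2)"
      using n by (simp add: algebra_simps)
    hence "\<alpha> / (4 * real r) \<le> 1 / real r + t - 1 + 2 * real (card (inequivalent_pairs d r V E)) / n\<^sup>2"
      using n by (simp only: mult_le_cancel_left_pos zero_less_power)
    thus False using Z by (simp add: n_def)
  qed
qed

text \<open>A maximum cut contains at least \<open>(1 - 1/r) m\<close> edges, hence separates a proportion of almost \<open>1 - 1/r\<close>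
of all pairs, and so it is nearly balanced.\<close>

lemma balanced_max_cut:
  assumes fin: "finite V" and n: "card V \<ge> 1" and r: "r \<ge> 1" and m: "m \<ge> 1"
    and E: "E \<in> nsets (nsets V 2) m"
  defines "t \<equiv> 1 / real (card V) + 2 * cut_discrepancy V E / real m"
  obtains \<kappa> where "\<kappa> \<in> V \<rightarrow> {..<r}" "card (crossing \<kappa> E) = max_cut r (V, E)"
    "real (\<Sum>u\<in>V. card {v \<in> V. \<kappa> v = \<kappa> u}) \<le> (real (card V))\<^sup>2 * (1 / real r + t)"
proof -
  have sub: "E \<subseteq> nsets V 2" "finite E" "card E = m" using E by (auto simp: nsets_def)
  obtain \<kappa> where \<kappa>: "\<kappa> \<in> V \<rightarrow> {..<r}" "card (crossing \<kappa> E) = max_cut r (V, E)"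
    using max_cut_attained[OF sub(1,2) r] by blast
  define N where "N = real (card (nsets V 2))"
  define k where "k = real (card V)"
  define D where "D = cut_discrepancy V E / real m"
  define c where "c = real (card (crossing \<kappa> (nsets V 2)))"
  have finU: "finite (nsets V 2)" using fin finite_imp_finite_nsets by blast
  have "card E \<le> card (nsets V 2)" using sub finU card_mono by blast
  hence N0: "N > 0" using m sub by (simp add: N_def del: card_nsets)
  have k0: "k \<ge> 1" using n by (simp add: k_def)
  have r0: "real r \<ge> 1" using r by simp
  have D0: "D \<ge> 0" using cut_discrepancy_nonneg[OF fin] by (simp add: D_def)
  have N2: "2 * N = k * (k - 1)" by (simp only: N_def k_def card_nsets_2)
  obtain f where f: "f \<in> V \<rightarrow>\<^sub>E {..<r}" "(r - 1) * card E \<le> r * card (crossing f E)"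
    using exists_large_cut[OF fin sub(1) r] by blast
  have "f \<in> V \<rightarrow> {..<r}" using f(1) by auto
  hence "card (crossing f E) \<le> card (crossing \<kappa> E)"
    using card_crossing_le_max_cut[OF _ sub(1,2)] \<kappa>(2) by simp
  hence "(r - 1) * m \<le> r * card (crossing \<kappa> E)"
    using f(2) sub(3) by (meson mult_le_mono2 order_trans)
  hence "real ((r - 1) * m) \<le> real (r * card (crossing \<kappa> E))" by (simp only: of_nat_le_iff)
  hence "(1 - 1 / real r) * real m \<le> real (card (crossing \<kappa> E))"
    using r by (simp add: of_nat_diff field_simps)
  also have "\<dots> \<le> real m / N * c + 2 * cut_discrepancy V E"
    using card_crossing_approx[OF fin E, of \<kappa>] unfolding N_def c_def by linarith
  also have "\<dots> = real m * (c / N + 2 * D)"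
    using m by (simp add: D_def algebra_simps)
  finally have "(1 - 1 / real r) * real m \<le> real m * (c / N + 2 * D)" .
  hence "real m * (1 - 1 / real r) \<le> real m * (c / N + 2 * D)" by (simp only: mult.commute)
  hence "1 - 1 / real r \<le> c / N + 2 * D" using m by (simp only: mult_le_cancel_left_pos of_nat_0_less_iff)
  hence "N * (1 - 1 / real r) \<le> N * (c / N + 2 * D)" using N0 by (intro mult_left_mono) auto
  also have "\<dots> = c + 2 * (D * N)" using N0 by (simp add: algebra_simps)
  finally have "2 * (N * (1 - 1 / real r)) - 4 * (D * N) \<le> 2 * c" by linarith
  hence "2 * N * (1 - 1 / real r - 2 * D) \<le> 2 * c" by (simp add: algebra_simps)
  hence "k * (k - 1) * (1 - 1 / real r - 2 * D) \<le> 2 * c" by (simp only: N2)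
  moreover have "k\<^sup>2 - k * (k - 1) * (1 - 1 / real r - 2 * D) \<le> k\<^sup>2 * (1 / real r + (1 / k + 2 * D))"
  proof -
    have "k\<^sup>2 * (1 / real r + (1 / k + 2 * D)) - (k\<^sup>2 - k * (k - 1) * (1 - 1 / real r - 2 * D)) =
        k / real r + k * (2 * D)"
      using k0 r0 by (simp add: field_simps power2_eq_square)
    moreover have "0 \<le> k / real r + k * (2 * D)" using k0 D0 by simp
    ultimately show ?thesis by linarith
  qed
  moreover have "real (\<Sum>u\<in>V. card {v \<in> V. \<kappa> v = \<kappa> u}) + 2 * c = k\<^sup>2"
    using arg_cong[OF sum_card_same_colour[OF fin, of \<kappa>], of real] by (simp add: c_def k_def)
  ultimately have "real (\<Sum>u\<in>V. card {v \<in> V. \<kappa> v = \<kappa> u}) \<le> k\<^sup>2 * (1 / real r + (1 / k + 2 * D))"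
    by linarith
  thus thesis using that[OF \<kappa>] by (simp add: t_def k_def D_def)
qed

text \<open>An upper bound for the number of ordered pairs inside the parts of a maximum cut, minus the number
of ordered pairs inside the \<open>(d, r)\<close>-components, both divided by \<open>n\<^sup>2\<close>. Since every component lies
inside a part, this quantity is nonnegative, and Markov's inequality applies to it.\<close>

definition core_excess :: "nat \<Rightarrow> nat \<Rightarrow> 'a set \<Rightarrow> 'a set set \<Rightarrow> real" where
  "core_excess d r V E = 1 / real r + (1 / real (card V) + 2 * cut_discrepancy V E / real (card E)) - 1
     + 2 * real (card (inequivalent_pairs d r V E)) / (real (card V))\<^sup>2"

lemma core_excess_nonneg:
  assumes fin: "finite V" and n: "card V \<ge> 1" and r: "r \<ge> 1" and m: "m \<ge> 1"
    and E: "E \<in> nsets (nsets V 2) m"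
  shows "0 \<le> core_excess d r V E"
proof -
  define t where "t = 1 / real (card V) + 2 * cut_discrepancy V E / real m"
  have sub: "E \<subseteq> nsets V 2" "card E = m" using E by (auto simp: nsets_def)
  obtain \<kappa> where \<kappa>: "\<kappa> \<in> V \<rightarrow> {..<r}" "card (crossing \<kappa> E) = max_cut r (V, E)"
    "real (\<Sum>u\<in>V. card {v \<in> V. \<kappa> v = \<kappa> u}) \<le> (real (card V))\<^sup>2 * (1 / real r + t)"
    using balanced_max_cut[OF fin n r m E] unfolding t_def by blast
  have "(\<Sum>u\<in>V. card (dr_equiv d r (V, E) `` {u})) \<le> (\<Sum>u\<in>V. card {v \<in> V. \<kappa> v = \<kappa> u})"
    using fin class_subset_colour_class[OF sub(1) \<kappa>(1,2)] by (intro sum_mono card_mono) auto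
  hence "real (\<Sum>u\<in>V. card (dr_equiv d r (V, E) `` {u})) \<le> (real (card V))\<^sup>2 * (1 / real r + t)"
    using \<kappa>(3) by linarith
  hence "0 \<le> (real (card V))\<^sup>2 * (1 / real r + t - 1) + 2 * real (card (inequivalent_pairs d r V E))"
    unfolding sum_card_dr_class[OF fin sub(1)] by (simp add: algebra_simps)
  also have "\<dots> = (real (card V))\<^sup>2 * core_excess d r V E"
    using n by (simp add: core_excess_def t_def sub(2) field_simps)
  finally show ?thesis using n by (simp add: zero_le_mult_iff)
qed

section \<open>Probability estimates\<close>

text \<open>With \<open>q = \<surd>(n/m)\<close>, each exchange step costs \<open>O(q/\<delta>)\<close>; the factor \<open>1/\<delta>\<close> comes from dividing by the
number of non-edges, which is at least \<open>\<delta>N/2\<close> because \<open>d < \<delta>N/2\<close>.\<close>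

lemma average_core_excess_le:
  assumes fin: "finite V" and r: "r \<ge> 1" and nm: "1 \<le> card V" "card V \<le> m"
    and \<delta>: "0 < \<delta>" "\<delta> < 1" and m: "real m \<le> (1 - \<delta>) * real (card (nsets V 2))"
    and d: "real d < \<delta> / 2 * real (card (nsets V 2))"
  defines "q \<equiv> sqrt (real (card V) / real m)"
  shows "average (nsets (nsets V 2) m) (core_excess d r V) \<le> 75 * ((real d + 1) / \<delta>) * q"
    and "average (nsets (nsets V 2) m) (\<lambda>E. 1 / real (card V) + 2 * cut_discrepancy V E / real m) \<le> 19 * q"
proof -
  define U where "U = nsets V 2"
  define N where "N = real (card U)"
  define n where "n = real (card V)"
  have n1: "n \<ge> 1" and m1: "real m \<ge> 1" "n \<le> real m" using nm by (auto simp: n_def)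
  have q: "q = sqrt (n / real m)" by (simp add: q_def n_def)
  have N2: "2 * N = n * (n - 1)" by (simp only: N_def U_def n_def card_nsets_2)
  have mN: "real m + \<delta> * N \<le> N" using m by (simp add: N_def U_def algebra_simps)
  have N0: "N \<ge> 0" by (simp add: N_def)
  have mleN: "real m \<le> N" using mN mult_nonneg_nonneg[of \<delta> N] \<delta> N0 by linarith
  hence N1: "N \<ge> 1" using m1 by linarith
  have n2: "n \<ge> 2"
  proof (rule ccontr)
    assume "\<not> n \<ge> 2"
    hence "card V = 1" using nm by (simp add: n_def)
    thus False using N2 N1 by (simp add: n_def)
  qed
  have "finite U" using fin finite_imp_finite_nsets unfolding U_def by blast
  hence \<Omega>: "finite (nsets U k)" "real k \<le> N \<Longrightarrow> nsets U k \<noteq> {}" for k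
    using finite_imp_finite_nsets by (auto simp: nsets_eq_empty_iff N_def)
  have q0: "q \<ge> 0" by (simp add: q_def)
  have invn: "1 / n \<le> q"
  proof -
    have "real m \<le> n * n" using mleN N2 n1 by (simp add: algebra_simps)
    moreover have "n * n * 1 \<le> n * n * n" using n1 by (intro mult_left_mono) auto
    ultimately have "real m \<le> n * n * n" by simp
    hence "(1 / n)\<^sup>2 \<le> n / real m" using m1 n1 by (simp add: field_simps power2_eq_square)
    thus ?thesis unfolding q by (rule real_le_rsqrt)
  qed
  have mean: "0 \<le> mean_discrepancy V k \<and> mean_discrepancy V k \<le> 9 * sqrt (n * real k)" if "m \<le> k" "real k \<le> N" for k
  proof -
    have "0 \<le> mean_discrepancy V k"
      unfolding mean_discrepancy_def average_def using cut_discrepancy_nonneg[OF fin]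
      by (intro divide_nonneg_nonneg sum_nonneg) auto
    moreover have "k \<le> card (nsets V 2)" using that(2) unfolding N_def U_def by (simp only: of_nat_le_iff)
    hence "mean_discrepancy V k \<le> 9 * sqrt (n * real k)"
      using average_cut_discrepancy_le[OF fin nm(1), of k] nm that by (simp add: mean_discrepancy_def n_def)
    ultimately show ?thesis by simp
  qed
  have ratio: "mean_discrepancy V k / real k \<le> 9 * q" if k: "m \<le> k" "real k \<le> N" for k
  proof -
    have k0: "real k > 0" "real m \<le> real k" using k m1 by auto
    have "mean_discrepancy V k / real k \<le> 9 * sqrt (n * real k) / real k"
      using mean[OF k] k0 by (intro divide_right_mono) auto
    also have "sqrt (n * real k) / real k = sqrt (n / real k)"
      using k0 by (simp add: real_sqrt_mult real_sqrt_divide field_simps)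
    hence "9 * sqrt (n * real k) / real k = 9 * sqrt (n / real k)" by simp
    also have "\<dots> \<le> 9 * q"
      unfolding q using k0 m1 n1 by (intro mult_left_mono real_sqrt_le_mono divide_left_mono) auto
    finally show ?thesis .
  qed
  have ratio': "mean_discrepancy V k / (N - real k) \<le> 18 / \<delta> * q" if k: "m \<le> k" "real k \<le> N" "\<delta> / 2 * N \<le> N - real k" for k
  proof -
    have pos: "\<delta> / 2 * N > 0" using \<delta> N1 by simp
    have "real m * real k \<le> N * N" using mleN k m1 by (intro mult_mono) auto
    hence "n * real k \<le> n / real m * (N * N)" using m1 n1 by (simp add: field_simps)
    hence "sqrt (n * real k) \<le> sqrt (n / real m * (N * N))" by (rule real_sqrt_le_mono)
    also have "\<dots> = q * N" by (simp only: q real_sqrt_mult real_sqrt_mult_self abs_of_nonneg[OF N0])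
    finally have "mean_discrepancy V k \<le> 9 * (q * N)" using mean[OF k(1,2)] by linarith
    hence "mean_discrepancy V k / (N - real k) \<le> 9 * (q * N) / (N - real k)"
      using pos k(3) by (intro divide_right_mono) auto
    also have "\<dots> \<le> 9 * (q * N) / (\<delta> / 2 * N)"
      using pos k(3) q0 N0 by (intro divide_left_mono mult_nonneg_nonneg mult_pos_pos[OF less_le_trans[OF pos k(3)] pos]) auto
    also have "\<dots> = 18 / \<delta> * q" using N1 \<delta> by (simp add: field_simps)
    finally show ?thesis .
  qed
  have room: "real k \<le> N" "real (Suc k) \<le> N" "k < card (nsets V 2)" "\<delta> / 2 * N \<le> N - real k" if "m \<le> k" "k \<le> m + d" for k
  proof -
    have "real k \<le> real m + real d" using that by (simp flip: of_nat_add)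
    moreover have "real d < \<delta> / 2 * N" using d by (simp add: N_def U_def)
    moreover have "\<delta> / 2 * N + \<delta> / 2 * N = \<delta> * N" by simp
    ultimately show *: "\<delta> / 2 * N \<le> N - real k" using mN by linarith
    have "\<delta> / 2 * N > 0" using \<delta> N1 by simp
    hence "real k < N" using * by linarith
    thus "k < card (nsets V 2)" unfolding N_def U_def by (simp only: of_nat_less_iff)
    thus "real (Suc k) \<le> N" "real k \<le> N" unfolding N_def U_def of_nat_le_iff by linarith+
  qed
  define \<eta> where "\<eta> = 54 / \<delta> * q"
  have step: "2 * mean_discrepancy V (Suc k) / real (Suc k) + 2 * mean_discrepancy V k / real (card (nsets V 2) - k) \<le> \<eta>"
    if k: "m \<le> k" "k \<le> m + d" for k
  proof -
    note R = room[OF k]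
    have "real (card (nsets V 2) - k) = N - real k"
      using R(3) unfolding N_def U_def by (intro of_nat_diff less_imp_le)
    moreover have "mean_discrepancy V (Suc k) / real (Suc k) \<le> 9 * q"
      using k R(2) by (intro ratio) auto
    moreover have "mean_discrepancy V k / (N - real k) \<le> 18 / \<delta> * q"
      using k R by (intro ratio') auto
    moreover have "18 * q \<le> 18 / \<delta> * q"
      using \<delta> q0 by (intro mult_right_mono) (auto simp: field_simps)
    ultimately show ?thesis unfolding \<eta>_def by simp
  qed
  have "mean_inequivalent d r V m \<le> (1 - 1 / real r) * n\<^sup>2 / (2 * N) + (real d + 1) * \<eta>"
    using mean_inequivalent_le[OF fin r room(3) step] by (simp add: n_def N_def U_def)
  also have "(1 - 1 / real r) * n\<^sup>2 / (2 * N) \<le> 1 - 1 / real r + 2 / n"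
  proof -
    have "n\<^sup>2 / (2 * N) = 1 + 1 / (n - 1)"
      unfolding N2 using n2 by (simp add: field_simps power2_eq_square)
    moreover have "1 / (n - 1) \<le> 2 / n" using n2 by (simp add: field_simps)
    ultimately have "n\<^sup>2 / (2 * N) \<le> 1 + 2 / n" by linarith
    hence "(1 - 1 / real r) * (n\<^sup>2 / (2 * N)) \<le> (1 - 1 / real r) * (1 + 2 / n)"
      using r by (intro mult_left_mono) auto
    also have "\<dots> \<le> 1 - 1 / real r + 2 / n" using r n2 by (simp add: algebra_simps)
    finally show ?thesis by simp
  qed
  finally have inq: "mean_inequivalent d r V m \<le> 1 - 1 / real r + 2 / n + (real d + 1) * \<eta>" by simp
  have disc: "average (nsets U m) (cut_discrepancy V) / real m \<le> 9 * q"
    using ratio[of m] mleN by (simp add: mean_discrepancy_def U_def)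
  have avt: "average (nsets U m) (\<lambda>E. 1 / n + 2 * cut_discrepancy V E / real m) =
      1 / n + 2 * (average (nsets U m) (cut_discrepancy V) / real m)"
    using \<Omega>(1)[of m] \<Omega>(2)[OF mleN] by (simp add: average_add average_const average_divide average_cmult)
  thus "average (nsets (nsets V 2) m) (\<lambda>E. 1 / real (card V) + 2 * cut_discrepancy V E / real m) \<le> 19 * q"
    using disc invn by (simp add: n_def U_def)
  have "average (nsets U m) (core_excess d r V) = average (nsets U m) (\<lambda>E. (1 / real r - 1) +
      (1 / n + 2 * cut_discrepancy V E / real m) + 2 / n\<^sup>2 * real (card (inequivalent_pairs d r V E)))"
    unfolding average_def
    by (intro arg_cong2[of _ _ _ _ "(/)"] sum.cong refl) (auto simp: core_excess_def nsets_def n_def)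
  also have "\<dots> = (1 / real r - 1) + (1 / n + 2 * (average (nsets U m) (cut_discrepancy V) / real m))
      + 2 / n\<^sup>2 * average (nsets U m) (\<lambda>E. real (card (inequivalent_pairs d r V E)))"
    unfolding average_add average_cmult avt[unfolded average_add]
    using \<Omega>(1)[of m] \<Omega>(2)[OF mleN] by (simp add: average_const)
  also have "average (nsets U m) (\<lambda>E. real (card (inequivalent_pairs d r V E))) = N * mean_inequivalent d r V m"
    unfolding mean_inequivalent_def U_def[symmetric] N_def[symmetric] using N1 by simp
  also have "2 / n\<^sup>2 * (N * mean_inequivalent d r V m) = (2 * N / n\<^sup>2) * mean_inequivalent d r V m" by simp
  also have "\<dots> \<le> 1 * mean_inequivalent d r V m"
  proof (rule mult_right_mono)
    show "2 * N / n\<^sup>2 \<le> 1" unfolding N2 using n1 by (simp add: field_simps power2_eq_square)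
    show "0 \<le> mean_inequivalent d r V m"
      unfolding mean_inequivalent_def average_def by (intro divide_nonneg_nonneg sum_nonneg) auto
  qed
  finally have "average (nsets U m) (core_excess d r V) \<le> 3 / n + 18 * q + (real d + 1) * \<eta>"
    using disc inq by (simp add: algebra_simps)
  also have "\<dots> \<le> 21 * q + (real d + 1) * \<eta>" using invn by simp
  also have "\<dots> \<le> 21 * ((real d + 1) / \<delta>) * q + (real d + 1) * \<eta>"
  proof -
    have "1 \<le> (real d + 1) / \<delta>" using \<delta> by (simp add: field_simps)
    hence "21 * q * 1 \<le> 21 * q * ((real d + 1) / \<delta>)" using q0 by (intro mult_left_mono) auto
    thus ?thesis by (simp only: mult_1_right mult_ac add_le_cancel_right)
  qed
  also have "\<dots> = 75 * ((real d + 1) / \<delta>) * q"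
    using \<delta> by (simp add: \<eta>_def field_simps)
  finally show "average (nsets (nsets V 2) m) (core_excess d r V) \<le> 75 * ((real d + 1) / \<delta>) * q"
    by (simp add: U_def)
qed

lemma prob_Gnm:
  assumes "m \<le> n choose 2"
  shows "measure_pmf.prob (Gnm n m) X =
    real (card {E \<in> nsets (nsets {1..n} 2) m. ({1..n}, E) \<in> X}) / real (card (nsets (nsets {1..n} 2) m))"
proof -
  let ?\<Omega> = "nsets (nsets {1..n} 2) m"
  have finU: "finite (nsets {1..n} 2)" by (intro finite_imp_finite_nsets) simp
  have S: "{G \<in> graphs_on {1..n}. card (edges G) = m} = Pair {1..n} ` ?\<Omega>"
  proof (rule set_eqI)
    fix G :: "nat graph"
    obtain W E where G: "G = (W, E)" by (cases G)
    have "finite E" if "E \<subseteq> nsets {1..n} 2" using finite_subset[OF that finU] .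
    hence "E \<in> ?\<Omega> \<longleftrightarrow> E \<subseteq> nsets {1..n} 2 \<and> card E = m"
      unfolding nsets_def[of "nsets {1..n} 2"] by blast
    thus "G \<in> {G \<in> graphs_on {1..n}. card (edges G) = m} \<longleftrightarrow> G \<in> Pair {1..n} ` ?\<Omega>"
      unfolding G graphs_on_def by auto
  qed
  have fin: "finite ?\<Omega>" using finU finite_imp_finite_nsets by blast
  have ne: "?\<Omega> \<noteq> {}" using assms finU by (simp add: nsets_eq_empty_iff)
  have inj: "inj_on (Pair {1..n}) A" for A :: "nat set set set" by (simp add: inj_on_def)
  have "measure_pmf.prob (Gnm n m) X = real (card (Pair {1..n} ` ?\<Omega> \<inter> X)) / real (card (Pair {1..n} ` ?\<Omega>))"
    unfolding Gnm_def S using fin ne by (intro measure_pmf_of_set) auto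
  also have "Pair {1..n} ` ?\<Omega> \<inter> X = Pair {1..n} ` {E \<in> ?\<Omega>. ({1..n}, E) \<in> X}" by auto
  finally show ?thesis by (simp only: card_image[OF inj])
qed

lemma not_core_imp_deviation:
  fixes \<alpha> :: real
  assumes V: "V = {1..n}" "n \<ge> 1" and r: "r \<ge> 1" and m: "m \<ge> 1" and E: "E \<in> nsets (nsets V 2) m"
    and \<alpha>: "0 < \<alpha>" "\<alpha> < 1 / ((real r)\<^sup>2 + real r)"
    and notcore: "(V, E) \<notin> CORE d r \<alpha>"
  shows "\<alpha> / (4 * real r) \<le> core_excess d r V E \<or>
    \<alpha> / 2 \<le> sqrt (1 / real (card V) + 2 * cut_discrepancy V E / real m)"
proof (rule ccontr)
  assume neg: "\<not> ?thesis"
  define t where "t = 1 / real (card V) + 2 * cut_discrepancy V E / real m"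
  have fin: "finite V" "V \<noteq> {}" "card V \<ge> 1" "card V = n" using V by auto
  have sub: "E \<subseteq> nsets V 2" "card E = m" using E by (auto simp: nsets_def)
  obtain \<kappa> where \<kappa>: "\<kappa> \<in> V \<rightarrow> {..<r}" "card (crossing \<kappa> E) = max_cut r (V, E)"
    "real (\<Sum>u\<in>V. card {v \<in> V. \<kappa> v = \<kappa> u}) \<le> (real (card V))\<^sup>2 * (1 / real r + t)"
    using balanced_max_cut[OF fin(1,3) r m E] unfolding t_def by blast
  have "sqrt t < \<alpha> / 2" using neg by (simp add: t_def)
  hence t: "t < (\<alpha> / 2)\<^sup>2" using real_le_rsqrt[of "\<alpha> / 2" t] by linarith
  have Z: "1 / real r + t - 1 + 2 * real (card (inequivalent_pairs d r V E)) / (real (card V))\<^sup>2 < \<alpha> / (4 * real r)"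
    using neg by (simp add: core_excess_def t_def sub(2))
  have "\<exists>\<K>. is_dr_core d r (V, E) \<K> \<and> (\<forall>A\<in>\<K>. real (card V) / real r - \<alpha> * real (card V) \<le> real (card A))"
    by (rule is_dr_core_of_balanced[OF fin(1) sub(1) fin(2) r \<kappa>(1,2) \<alpha> \<kappa>(3) t Z])
  moreover have "(V, E) \<in> graphs_on {1..n}" using sub V by (simp add: graphs_on_def)
  ultimately have "(V, E) \<in> CORE d r \<alpha>" unfolding CORE_def fin(4) by blast
  thus False using notcore by simp
qed

text \<open>Markov's inequality for the excess gives the term with \<open>\<surd>(n/m)\<close>. For the imbalance of the maximum
cut it is applied to the square root of a quantity of mean \<open>O(\<surd>(n/m))\<close>, which gives the fourth
root.\<close>

lemma prob_not_core_le:
  fixes \<alpha> \<delta> :: real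
  assumes r: "r \<ge> 2" and n: "1 \<le> n" "n \<le> m"
    and \<alpha>: "0 < \<alpha>" "\<alpha> < 1 / ((real r)\<^sup>2 + real r)"
    and \<delta>: "0 < \<delta>" "\<delta> < 1" and m: "real m \<le> (1 - \<delta>) * real (n choose 2)"
    and d: "real d < \<delta> / 2 * real (n choose 2)"
  shows "measure_pmf.prob (Gnm n m) {G. G \<notin> CORE d r \<alpha>} \<le>
    150 * real r ^ 2 / \<alpha> * ((real d + 1) / \<delta> * sqrt (real n / real m) + root 4 (real n / real m))"
proof -
  define V where "V = {1..n}"
  define \<Omega> where "\<Omega> = nsets (nsets V 2) m"
  define q where "q = sqrt (real n / real m)"
  define t where "t = (\<lambda>E. 1 / real (card V) + 2 * cut_discrepancy V E / real m)"
  have V: "finite V" "card V = n" by (simp_all add: V_def)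
  have m1: "m \<ge> 1" using n by simp
  have mN: "m \<le> n choose 2"
  proof -
    have "(1 - \<delta>) * real (n choose 2) \<le> 1 * real (n choose 2)"
      using \<delta> by (intro mult_right_mono) auto
    hence "real m \<le> real (n choose 2)" using m by linarith
    thus ?thesis by (simp only: of_nat_le_iff)
  qed
  have q0: "q > 0" using n m1 by (simp add: q_def)
  have finU: "finite (nsets V 2)" using V finite_imp_finite_nsets by blast
  have fin: "finite \<Omega>" unfolding \<Omega>_def using finU finite_imp_finite_nsets by blast
  have ne: "\<Omega> \<noteq> {}" unfolding \<Omega>_def using mN finU V by (simp add: nsets_eq_empty_iff)
  have av: "average \<Omega> (core_excess d r V) \<le> 75 * ((real d + 1) / \<delta>) * q" "average \<Omega> t \<le> 19 * q"
    using average_core_excess_le[OF V(1), of r m \<delta> d] r n \<delta> m d by (simp_all add: \<Omega>_def t_def V(2) q_def)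
  have tnn: "0 \<le> t E" for E using cut_discrepancy_nonneg[OF V(1)] by (simp add: t_def)
  have "measure_pmf.prob (Gnm n m) {G. G \<notin> CORE d r \<alpha>} =
      real (card {E \<in> \<Omega>. (V, E) \<notin> CORE d r \<alpha>}) / real (card \<Omega>)"
    unfolding \<Omega>_def V_def prob_Gnm[OF mN] by simp
  also have "\<dots> \<le> real (card ({E \<in> \<Omega>. \<alpha> / (4 * real r) \<le> core_excess d r V E} \<union> {E \<in> \<Omega>. \<alpha> / 2 \<le> sqrt (t E)})) / real (card \<Omega>)"
  proof (intro divide_right_mono of_nat_mono card_mono)
    show "{E \<in> \<Omega>. (V, E) \<notin> CORE d r \<alpha>} \<subseteq> {E \<in> \<Omega>. \<alpha> / (4 * real r) \<le> core_excess d r V E} \<union> {E \<in> \<Omega>. \<alpha> / 2 \<le> sqrt (t E)}"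
      using not_core_imp_deviation[OF V_def n(1) _ m1 _ \<alpha>] r unfolding \<Omega>_def t_def by auto
  qed (use fin in auto)
  also have "\<dots> \<le> (real (card {E \<in> \<Omega>. \<alpha> / (4 * real r) \<le> core_excess d r V E}) + real (card {E \<in> \<Omega>. \<alpha> / 2 \<le> sqrt (t E)})) / real (card \<Omega>)"
    by (intro divide_right_mono) (simp_all add: card_Un_le flip: of_nat_add)
  also have "\<dots> = real (card {E \<in> \<Omega>. \<alpha> / (4 * real r) \<le> core_excess d r V E}) / real (card \<Omega>)
      + real (card {E \<in> \<Omega>. \<alpha> / 2 \<le> sqrt (t E)}) / real (card \<Omega>)"
    by (rule add_divide_distrib)
  also have "\<dots> \<le> average \<Omega> (core_excess d r V) / (\<alpha> / (4 * real r)) + average \<Omega> (\<lambda>E. sqrt (t E)) / (\<alpha> / 2)"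
    using \<alpha>(1) r core_excess_nonneg[OF V(1) _ _ m1] n(1) V(2) tnn
    by (intro add_mono average_markov fin) (auto simp: \<Omega>_def)
  also have "\<dots> \<le> (75 * ((real d + 1) / \<delta>) * q) / (\<alpha> / (4 * real r)) + (5 * sqrt q) / (\<alpha> / 2)"
  proof -
    have "average \<Omega> (\<lambda>E. sqrt (t E)) \<le> sqrt (19 * q)"
      using tnn av(2) q0 by (intro average_sqrt_le fin ne) auto
    also have "\<dots> \<le> sqrt (25 * q)" using q0 by (intro real_sqrt_le_mono) simp
    also have "\<dots> = 5 * sqrt q" by (simp add: real_sqrt_mult)
    finally show ?thesis using av(1) \<alpha>(1) r by (intro add_mono divide_right_mono) auto
  qed
  also have "\<dots> = (300 * real r * ((real d + 1) / \<delta> * q) + 10 * sqrt q) / \<alpha>"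
    using \<alpha>(1) \<delta>(1) r by (simp add: field_simps)
  also have "\<dots> \<le> (150 * real r ^ 2 * ((real d + 1) / \<delta> * q) + 150 * real r ^ 2 * sqrt q) / \<alpha>"
  proof (intro divide_right_mono add_mono mult_right_mono)
    have "real r * 2 \<le> real r * real r" using r by (intro mult_left_mono) auto
    thus "300 * real r \<le> 150 * real r ^ 2" by (simp add: power2_eq_square)
    have "2 \<le> real r" using r by simp
    thus "10 \<le> 150 * real r ^ 2" using \<open>300 * real r \<le> 150 * real r ^ 2\<close> by linarith
  qed (use q0 \<delta> \<alpha> in auto)
  also have "sqrt q = root 4 (real n / real m)"
    using real_root_mult_exp[of 2 2 "real n / real m"] by (simp add: q_def sqrt_def)
  also have "(150 * real r ^ 2 * ((real d + 1) / \<delta> * q) + 150 * real r ^ 2 * root 4 (real n / real m)) / \<alpha> =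
      150 * real r ^ 2 / \<alpha> * ((real d + 1) / \<delta> * sqrt (real n / real m) + root 4 (real n / real m))"
    by (simp add: q_def algebra_simps add_divide_distrib)
  finally show ?thesis .
qed

theorem corollary2p2:
  shows "\<exists>C::real. \<forall>(\<alpha>::real) (\<delta>::real) (d::nat) (m::nat) (n::nat) (r::nat).
    0 < \<alpha> \<and> \<alpha> < 1 \<and> 0 < \<delta> \<and> \<delta> < 1 \<and> r \<ge> 2 \<and> \<alpha> < 1 / (real r ^ 2 + real r) \<and>
    1 \<le> m \<and> real m \<le> (1 - \<delta>) * real (n choose 2) \<longrightarrow>
    measure_pmf.prob (Gnm n m) {G. G \<notin> CORE d r \<alpha>}
      \<le> C * real r ^ 2 / \<alpha> *
          (((real d + 1) / \<delta> + real r) * sqrt (real n / real m) + root 4 (real n / real m))"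
proof (rule exI[of _ 150], intro allI impI, elim conjE)
  fix \<alpha> \<delta> :: real and d m n r :: nat
  assume \<alpha>: "0 < \<alpha>" "\<alpha> < 1" and \<delta>: "0 < \<delta>" "\<delta> < 1" and r: "r \<ge> 2"
    and \<alpha>r: "\<alpha> < 1 / (real r ^ 2 + real r)"
    and m: "1 \<le> m" "real m \<le> (1 - \<delta>) * real (n choose 2)"
  define p where "p = measure_pmf.prob (Gnm n m) {G. G \<notin> CORE d r \<alpha>}"
  define q where "q = sqrt (real n / real m)"
  define w where "w = root 4 (real n / real m)"
  define b where "b = (real d + 1) / \<delta>"
  have b0: "b > 0" using \<delta> by (simp add: b_def)
  have q0: "q \<ge> 0" and w0: "w \<ge> 0" by (simp_all add: q_def w_def)
  have r4: "4 \<le> real r ^ 2" using r power_mono[of 2 "real r" 2] by simp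
  hence "2 * \<alpha> \<le> 150 * real r ^ 2" using \<alpha> by linarith
  hence C2: "2 \<le> 150 * real r ^ 2 / \<alpha>" using \<alpha> by (simp add: field_simps)
  have N1: "real (n choose 2) > 0"
  proof -
    have "0 < (1 - \<delta>) * real (n choose 2)" using m by linarith
    thus ?thesis using \<delta> by (simp add: zero_less_mult_iff)
  qed
  have n1: "n \<ge> 1" using N1 by (cases n) auto
  have split: "b * q + w \<le> (b + real r) * q + w" using q0 by (simp add: algebra_simps)
  have "p \<le> 150 * real r ^ 2 / \<alpha> * (b * q + w)"
  proof (cases "n \<le> m \<and> real d < \<delta> / 2 * real (n choose 2)")
    case True
    thus ?thesis
      using prob_not_core_le[OF r n1 _ \<alpha>(1) \<alpha>r \<delta> m(2)] by (simp add: p_def q_def w_def b_def)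
  next
    case False
    \<comment> \<open>In the remaining cases the right-hand side is at least 1.\<close>
    have "1 / 2 \<le> b * q + w"
    proof (cases "n \<le> m")
      case True
      hence d: "real d \<ge> \<delta> / 2 * real (n choose 2)" using False by simp
      have mN: "real m \<le> real (n choose 2)"
      proof -
        have "(1 - \<delta>) * real (n choose 2) \<le> 1 * real (n choose 2)"
          using \<delta> by (intro mult_right_mono) auto
        thus ?thesis using m by linarith
      qed
      have "real (n choose 2) / 2 \<le> b"
        using d \<delta> by (simp add: b_def field_simps)
      hence b: "real m / 2 \<le> b" using mN by simp
      have "1 / real m \<le> q"
      proof -
        have "1 / real m * (1 / real m) \<le> 1 * (1 / real m)" using m by (intro mult_right_mono) auto
        also have "\<dots> \<le> real n / real m" using n1 by (simp add: divide_right_mono)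
        finally have "(1 / real m)\<^sup>2 \<le> real n / real m" by (simp add: power2_eq_square)
        thus ?thesis unfolding q_def by (rule real_le_rsqrt)
      qed
      hence "real m / 2 * (1 / real m) \<le> b * q" using b b0 by (intro mult_mono) auto
      thus ?thesis using m w0 by simp
    next
      case False
      hence "1 \<le> real n / real m" using m by simp
      hence "1 \<le> w" unfolding w_def by simp
      moreover have "0 \<le> b * q" using b0 q0 by simp
      ultimately show ?thesis by linarith
    qed
    hence "2 * (1 / 2) \<le> 150 * real r ^ 2 / \<alpha> * (b * q + w)"
      using C2 by (intro mult_mono) auto
    moreover have "p \<le> 1" unfolding p_def by simp
    ultimately show ?thesis by linarith
  qed
  also have "\<dots> \<le> 150 * real r ^ 2 / \<alpha> * ((b + real r) * q + w)"
    using C2 by (intro mult_left_mono split) auto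
  finally show "measure_pmf.prob (Gnm n m) {G. G \<notin> CORE d r \<alpha>}
      \<le> 150 * real r ^ 2 / \<alpha> *
          (((real d + 1) / \<delta> + real r) * sqrt (real n / real m) + root 4 (real n / real m))"
    by (simp only: p_def q_def w_def b_def)
qed

end
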